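(* Let $\alpha\ge\beta>0$, $\sigma>0$, $\eta=\alpha\beta$. For $z\in\mathbb C$ define the complex-valued measure $\rho_{\alpha,\beta,\sigma,z}$ on $X_{\alpha,\beta}$ by $$\rho_{\alpha,\beta,\sigma,z}(dx)=\int_{\mathbb N_0}\mu_{\alpha,\beta,\eta\xi+\sigma}(dx)\,\pi_{\frac z\beta}(d\xi).$$ Then for each $f\in L^2(X_{\alpha,\beta},\mu_{\alpha,\beta,\sigma})$, $$(\mathbb Sf)(z)=\int_{X_{\alpha,\beta}}f(x)\,\rho_{\alpha,\beta,\sigma,z}(dx),\qquad z\in\mathbb C,$$ where $\mathbb S:L^2(X_{\alpha,\beta},\mu_{\alpha,\beta,\sigma})\to\mathbb F_{\eta,\sigma}(\mathbb C)$ is the generalized Segal–Bargmann transform, i.e. the unitary operator with $(\mathbb Ss_n)(z)=z^n$ for all $n\in\mathbb N_0$.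
   Context: Notation: $\mathbb N_0=\{0,1,2,\dots\}$; $(z\mid h)_0=1$, $(z\mid h)_n=z(z-h)\cdots(z-(n-1)h)$; $(z)^{(n)}=(z\mid-1)_n$. Here $\lambda=\alpha+\beta$, $\eta=\alpha\beta$, and $(s_n)_{n\ge0}$ is the monic polynomial sequence with $s_0=1$ and $xs_n(x)=s_{n+1}(x)+(\lambda n+\sigma/\alpha)s_n(x)+(\sigma n+\eta n(n-1))s_{n-1}(x)$. For each $\sigma>0$, $\mu_{\alpha,\beta,\sigma}$ is the following probability measure on $X_{\alpha,\beta}$, with respect to which $(s_n)$ is orthogonal with $\|s_n\|^2=n!\,(\sigma\mid-\eta)_n$: - if $\alpha=\beta$: $X_{\alpha,\beta}=(0,\infty)$, $\mu_{\alpha,\alpha,\sigma}(dx)=\frac1{\Gamma(\sigma/\eta)}\alpha^{-\sigma/\eta}x^{-1+\sigma/\eta}e^{-x/\alpha}dx$; - if $\alpha>\beta$: $X_{\alpha,\beta}=(\alpha-\beta)\mathbb N_0$, $\mu_{\alpha,\beta,\sigma}=(1-\frac\beta\alpha)^{\sigma/\eta}\sum_{n\ge0}(\frac\beta\alpha)^n\frac1{n!}(\frac\sigma\eta)^{(n)}\delta_{(\alpha-\beta)n}$. The measure $\mu_{\alpha,\beta,\eta\xi+\sigma}$ is obtained by replacing $\sigma$ with $\eta\xi+\sigma$ (with $\alpha,\beta,\eta$ unchanged). For $\zeta\in\mathbb C$, $\pi_\zeta=e^{-\zeta}\sum_{n\ge0}\frac{\zeta^n}{n!}\delta_n$ (complex-valued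 Poisson measure on $\mathbb N_0$). $\mathbb F_{\eta,\sigma}(\mathbb C)$ is the Hilbert space of entire functions $\varphi(z)=\sum_nf_nz^n$ with $\|\varphi\|^2=\sum_n|f_n|^2n!\,(\sigma\mid-\eta)_n<\infty$ (so the $z^n$ are orthogonal with $\|z^n\|^2=n!\,(\sigma\mid-\eta)_n$). $L^2$ spaces are complex. *)

theory Defs
  imports "HOL-Complex_Analysis.Complex_Analysis"
begin

text \<open>The generalized factorial \<open>(z | h)\<^sub>n = z (z - h) \<dots> (z - (n - 1) h)\<close>.\<close>

definition gen_fact :: "real \<Rightarrow> real \<Rightarrow> nat \<Rightarrow> real" where
  "gen_fact z h n = (\<Prod>k<n. z - real k * h)"

fun sheffer :: "real \<Rightarrow> real \<Rightarrow> real \<Rightarrow> nat \<Rightarrow> real poly" where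
  "sheffer \<alpha> \<beta> \<sigma> 0 = 1"
| "sheffer \<alpha> \<beta> \<sigma> (Suc 0) = [:- (\<sigma> / \<alpha>), 1:]"
| "sheffer \<alpha> \<beta> \<sigma> (Suc (Suc n)) =
     [:- ((\<alpha> + \<beta>) * real (Suc n) + \<sigma> / \<alpha>), 1:] * sheffer \<alpha> \<beta> \<sigma> (Suc n)
     - smult (\<sigma> * real (Suc n) + \<alpha> * \<beta> * real (Suc n) * real n) (sheffer \<alpha> \<beta> \<sigma> n)"

text \<open>The recurrence in its usual form; for \<open>n = 0\<close> the last coefficient vanishes, so the
  value of \<open>n - 1\<close> is irrelevant there.\<close>

lemma sheffer_recurrence:
  "x * poly (sheffer \<alpha> \<beta> \<sigma> n) x =
     poly (sheffer \<alpha> \<beta> \<sigma> (Suc n)) x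
     + ((\<alpha> + \<beta>) * real n + \<sigma> / \<alpha>) * poly (sheffer \<alpha> \<beta> \<sigma> n) x
     + (\<sigma> * real n + \<alpha> * \<beta> * real n * (real n - 1)) * poly (sheffer \<alpha> \<beta> \<sigma> (n - 1)) x"
  by (cases n) (simp_all add: algebra_simps)

definition carrier_X :: "real \<Rightarrow> real \<Rightarrow> real set" where
  "carrier_X \<alpha> \<beta> = (if \<alpha> = \<beta> then {0<..} else range (\<lambda>n. (\<alpha> - \<beta>) * real n))"

text \<open>A measure on \<^term>\<open>carrier_X \<alpha> \<beta>\<close>, carrying the Borel sets of the half-line if
  \<open>\<alpha> = \<beta>\<close> and all subsets if \<open>\<alpha> > \<beta>\<close>; the measurable sets do not depend on \<open>\<sigma>\<close>.
  The \<open>distr\<close> in the second case is the sum of point masses at \<open>(\<alpha> - \<beta>) n\<close>.\<close>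

definition mu :: "real \<Rightarrow> real \<Rightarrow> real \<Rightarrow> real measure" where
  "mu \<alpha> \<beta> \<sigma> =
    (if \<alpha> = \<beta> then
       density (restrict_space lborel (carrier_X \<alpha> \<beta>))
         (\<lambda>x. ennreal (1 / Gamma (\<sigma> / (\<alpha> * \<beta>)) * \<alpha> powr (- \<sigma> / (\<alpha> * \<beta>))
                        * x powr (- 1 + \<sigma> / (\<alpha> * \<beta>)) * exp (- x / \<alpha>)))
     else
       distr
         (density (count_space UNIV)
           (\<lambda>n. ennreal ((1 - \<beta> / \<alpha>) powr (\<sigma> / (\<alpha> * \<beta>))
                          * ((\<beta> / \<alpha>) ^ n * (1 / fact n) * pochhammer (\<sigma> / (\<alpha> * \<beta>)) n))))
         (count_space (carrier_X \<alpha> \<beta>))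
         (\<lambda>n. (\<alpha> - \<beta>) * real n))"

lemma space_mu: "space (mu \<alpha> \<beta> \<sigma>) = carrier_X \<alpha> \<beta>"
  by (simp add: mu_def space_restrict_space)

lemma sets_mu: "sets (mu \<alpha> \<beta> \<sigma>) = sets (mu \<alpha> \<beta> \<tau>)"
  by (simp add: mu_def)

text \<open>A complex measure is a set function \<open>\<nu>\<close> on the measurable sets of \<open>M\<close>; of \<open>M\<close> itself only the
  space and the \<open>\<sigma>\<close>-algebra are used here, never its measure. Integrals against \<open>\<nu>\<close> are
  defined through the Jordan decompositions of its real and imaginary parts.\<close>

definition complex_measure :: "'a measure \<Rightarrow> ('a set \<Rightarrow> complex) \<Rightarrow> bool" where
  "complex_measure M \<nu> \<longleftrightarrow>
     \<nu> {} = 0 \<and>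
     (\<forall>A. range A \<subseteq> sets M \<longrightarrow> disjoint_family A \<longrightarrow>
        (\<lambda>n::nat. \<nu> (A n)) sums \<nu> (\<Union>n. A n))"

definition pos_variation :: "'a measure \<Rightarrow> ('a set \<Rightarrow> real) \<Rightarrow> 'a measure" where
  "pos_variation M \<nu> =
     measure_of (space M) (sets M) (\<lambda>A. SUP B\<in>{B \<in> sets M. B \<subseteq> A}. ennreal (\<nu> B))"

definition neg_variation :: "'a measure \<Rightarrow> ('a set \<Rightarrow> real) \<Rightarrow> 'a measure" where
  "neg_variation M \<nu> = pos_variation M (\<lambda>A. - \<nu> A)"

definition cm_integrable ::
    "'a measure \<Rightarrow> ('a set \<Rightarrow> complex) \<Rightarrow> ('a \<Rightarrow> complex) \<Rightarrow> bool" where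
  "cm_integrable M \<nu> f \<longleftrightarrow>
     integrable (pos_variation M (\<lambda>A. Re (\<nu> A))) f \<and>
     integrable (neg_variation M (\<lambda>A. Re (\<nu> A))) f \<and>
     integrable (pos_variation M (\<lambda>A. Im (\<nu> A))) f \<and>
     integrable (neg_variation M (\<lambda>A. Im (\<nu> A))) f"

definition cm_integral ::
    "'a measure \<Rightarrow> ('a set \<Rightarrow> complex) \<Rightarrow> ('a \<Rightarrow> complex) \<Rightarrow> complex" where
  "cm_integral M \<nu> f =
     (LINT x|pos_variation M (\<lambda>A. Re (\<nu> A)). f x)
     - (LINT x|neg_variation M (\<lambda>A. Re (\<nu> A)). f x)
     + \<i> * ((LINT x|pos_variation M (\<lambda>A. Im (\<nu> A)). f x)
            - (LINT x|neg_variation M (\<lambda>A. Im (\<nu> A)). f x))"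

definition complex_poisson :: "complex \<Rightarrow> nat set \<Rightarrow> complex" where
  "complex_poisson \<zeta> A = exp (- \<zeta>) * (\<Sum>n. \<zeta> ^ n / fact n * indicator A n)"

definition rho :: "real \<Rightarrow> real \<Rightarrow> real \<Rightarrow> complex \<Rightarrow> real set \<Rightarrow> complex" where
  "rho \<alpha> \<beta> \<sigma> z A =
     cm_integral (count_space UNIV) (complex_poisson (z / of_real \<beta>))
       (\<lambda>\<xi>. of_real (measure (mu \<alpha> \<beta> (\<alpha> * \<beta> * real \<xi> + \<sigma>)) A))"

text \<open>Elements of \<open>L\<^sup>2\<close> are represented by functions. A map satisfying \<open>is_unitary\<close>
  below takes equal values on functions that agree almost everywhere, because their difference has
  norm zero.\<close>

definition L2 :: "'a measure \<Rightarrow> ('a \<Rightarrow> complex) set" where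
  "L2 M = {f \<in> borel_measurable M. integrable M (\<lambda>x. (cmod (f x))\<^sup>2)}"

definition L2_inner :: "'a measure \<Rightarrow> ('a \<Rightarrow> complex) \<Rightarrow> ('a \<Rightarrow> complex) \<Rightarrow> complex" where
  "L2_inner M f g = (LINT x|M. f x * cnj (g x))"

definition taylor_coeff :: "(complex \<Rightarrow> complex) \<Rightarrow> nat \<Rightarrow> complex" where
  "taylor_coeff \<phi> n = (deriv ^^ n) \<phi> 0 / fact n"

definition fock :: "real \<Rightarrow> real \<Rightarrow> (complex \<Rightarrow> complex) set" where
  "fock \<eta> \<sigma> = {\<phi>. \<phi> holomorphic_on UNIV \<and>
     summable (\<lambda>n. (cmod (taylor_coeff \<phi> n))\<^sup>2 * (fact n * gen_fact \<sigma> (- \<eta>) n))}"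

definition fock_inner ::
    "real \<Rightarrow> real \<Rightarrow> (complex \<Rightarrow> complex) \<Rightarrow> (complex \<Rightarrow> complex) \<Rightarrow> complex" where
  "fock_inner \<eta> \<sigma> \<phi> \<psi> =
     (\<Sum>n. taylor_coeff \<phi> n * cnj (taylor_coeff \<psi> n)
            * of_real (fact n * gen_fact \<sigma> (- \<eta>) n))"

definition is_unitary ::
    "'a measure \<Rightarrow> real \<Rightarrow> real \<Rightarrow> (('a \<Rightarrow> complex) \<Rightarrow> (complex \<Rightarrow> complex)) \<Rightarrow> bool" where
  "is_unitary M \<eta> \<sigma> S \<longleftrightarrow>
     (\<forall>f\<in>L2 M. \<forall>g\<in>L2 M. S (\<lambda>x. f x + g x) = (\<lambda>z. S f z + S g z)) \<and>
     (\<forall>c. \<forall>f\<in>L2 M. S (\<lambda>x. c * f x) = (\<lambda>z. c * S f z)) \<and>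
     S ` L2 M = fock \<eta> \<sigma> \<and>
     (\<forall>f\<in>L2 M. \<forall>g\<in>L2 M. fock_inner \<eta> \<sigma> (S f) (S g) = L2_inner M f g)"

definition is_segal_bargmann ::
    "real \<Rightarrow> real \<Rightarrow> real \<Rightarrow> ((real \<Rightarrow> complex) \<Rightarrow> (complex \<Rightarrow> complex)) \<Rightarrow> bool" where
  "is_segal_bargmann \<alpha> \<beta> \<sigma> S \<longleftrightarrow>
     is_unitary (mu \<alpha> \<beta> \<sigma>) (\<alpha> * \<beta>) \<sigma> S \<and>
     (\<forall>n z. S (\<lambda>x. of_real (poly (sheffer \<alpha> \<beta> \<sigma> n) x)) z = z ^ n)"

end

theory Submission
  imports Defs
begin

text \<open>Put \<open>\<eta> = \<alpha>\<beta>\<close>, \<open>w\<^sub>n = n! (\<sigma> | -\<eta>)\<^sub>n\<close> and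
  \<open>p\<^sub>m(x) = \<Prod>k<m. (x + (\<alpha> - \<beta>)(\<sigma>/\<eta> + k))\<close>. The measure with parameter \<open>\<eta>m + \<sigma>\<close> has density
  \<open>\<beta>\<^sup>m m! p\<^sub>m / w\<^sub>m\<close> with respect to the one with parameter \<open>\<sigma>\<close>, so the complex measure in the
  theorem has density \<open>k\<^sub>z(x) = exp(-z/\<beta>) \<Sum>m. z\<^sup>m p\<^sub>m(x) / w\<^sub>m\<close>. Comparing differential equations in \<open>z\<close>
  gives \<open>\<Sum>m. z\<^sup>m p\<^sub>m(x) / w\<^sub>m = exp(z/\<beta>) \<Sum>n. z\<^sup>n s\<^sub>n(x) / w\<^sub>n\<close>. On the other hand, unitarity identifies
  the Taylor coefficients of \<open>S f\<close>, whence \<open>S f z = \<Sum>n. z\<^sup>n \<langle>f, s\<^sub>n\<rangle> / w\<^sub>n\<close>, which is the integral of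
  \<open>f k\<^sub>z\<close>.\<close>

section \<open>Complex measures given by a density\<close>

text \<open>The supremum is attained at the Hahn set, the part of \<open>A\<close> where
  \<open>h\<close> is nonnegative. Since \<open>ennreal\<close> sends negative reals to 0, the
  density is the positive part of \<open>h\<close>.\<close>

lemma pos_variation_integral:
  fixes h :: "'a \<Rightarrow> real"
  assumes h: "integrable M h"
    and \<nu>: "\<And>A. A \<in> sets M \<Longrightarrow> \<nu> A = (LINT x:A|M. h x)"
  shows "pos_variation M \<nu> = density M (\<lambda>x. ennreal (h x))"
proof -
  let ?N = "density M (\<lambda>x. ennreal (h x))"
  have [measurable]: "h \<in> borel_measurable M" using h by auto
  have le: "ennreal (\<nu> B) \<le> emeasure ?N A" if B: "B \<in> sets M" "B \<subseteq> A" and A: "A \<in> sets M" for A B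
  proof -
    have i: "integrable M (\<lambda>x. indicator B x * h x)"
      using integrable_mult_indicator[OF B(1) h] by simp
    have "ennreal (\<nu> B) = ennreal (LINT x|M. indicator B x * h x)"
      using \<nu>[OF B(1)] by (simp add: set_lebesgue_integral_def)
    also have "\<dots> \<le> ennreal (LINT x|M. max 0 (indicator B x * h x))"
      using i by (intro ennreal_leI integral_mono) auto
    also have "\<dots> = (\<integral>\<^sup>+x. ennreal (max 0 (indicator B x * h x)) \<partial>M)"
      using i by (intro nn_integral_eq_integral[symmetric]) auto
    also have "\<dots> \<le> (\<integral>\<^sup>+x. ennreal (h x) * indicator A x \<partial>M)"
      using B by (intro nn_integral_mono) (auto simp: ennreal_max_0 split: split_indicator)
    also have "\<dots> = emeasure ?N A" using A by (simp add: emeasure_density)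
    finally show ?thesis .
  qed
  have ge: "emeasure ?N A = ennreal (\<nu> (A \<inter> {x \<in> space M. 0 \<le> h x}))" if A: "A \<in> sets M" for A
  proof -
    let ?B = "A \<inter> {x \<in> space M. 0 \<le> h x}"
    have [measurable]: "?B \<in> sets M" using A by auto
    have i: "integrable M (\<lambda>x. indicator ?B x * h x)"
      using integrable_mult_indicator[of ?B M h] h by simp
    have "ennreal (\<nu> ?B) = ennreal (LINT x|M. indicator ?B x * h x)"
      by (simp add: \<nu> set_lebesgue_integral_def)
    also have "\<dots> = (\<integral>\<^sup>+x. ennreal (indicator ?B x * h x) \<partial>M)"
      using i by (intro nn_integral_eq_integral[symmetric]) (auto split: split_indicator)
    also have "\<dots> = (\<integral>\<^sup>+x. ennreal (h x) * indicator A x \<partial>M)"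
      by (intro nn_integral_cong) (auto simp: ennreal_neg split: split_indicator)
    also have "\<dots> = emeasure ?N A" using A by (simp add: emeasure_density)
    finally show ?thesis by simp
  qed
  have "(SUP B\<in>{B \<in> sets M. B \<subseteq> A}. ennreal (\<nu> B)) = emeasure ?N A" if "A \<in> sets M" for A
  proof (rule antisym)
    show "(SUP B\<in>{B \<in> sets M. B \<subseteq> A}. ennreal (\<nu> B)) \<le> emeasure ?N A"
      using le that by (auto intro!: SUP_least)
    show "emeasure ?N A \<le> (SUP B\<in>{B \<in> sets M. B \<subseteq> A}. ennreal (\<nu> B))"
      unfolding ge[OF that] using that by (intro SUP_upper) auto
  qed
  then have "pos_variation M \<nu> = measure_of (space M) (sets M) (emeasure ?N)"
    unfolding pos_variation_def
    by (intro measure_of_eq sets.space_closed) (simp add: sets.sigma_sets_eq)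
  also have "\<dots> = ?N"
    using measure_of_of_measure[of ?N] by simp
  finally show ?thesis .
qed

text \<open>The four variations have the positive parts of \<open>Re h\<close>,
  \<open>- Re h\<close>, \<open>Im h\<close> and \<open>- Im h\<close> as densities. All are bounded
  by \<open>cmod h\<close>, so integrability of \<open>f * h\<close> gives the four integrals, which
  recombine by linearity.\<close>

lemma cm_integral_density:
  fixes h f :: "'a \<Rightarrow> complex"
  assumes h: "integrable M h"
    and \<nu>: "\<And>A. A \<in> sets M \<Longrightarrow> \<nu> A = (LINT x:A|M. h x)"
    and f[measurable]: "f \<in> borel_measurable M"
    and fh: "integrable M (\<lambda>x. f x * h x)"
  shows "cm_integrable M \<nu> f" and "cm_integral M \<nu> f = (LINT x|M. f x * h x)"
proof -
  have hm[measurable]: "h \<in> borel_measurable M" using h by auto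
  have hi: "set_integrable M A h" if "A \<in> sets M" for A
    using h that by (simp add: set_integrable_def integrable_mult_indicator)
  \<comment> \<open>The \<open>max 0\<close> is invisible under \<open>ennreal\<close> but makes the
    real density nonnegative, as the conversion to an integral over \<open>M\<close>
    requires.\<close>
  define D where "D = (\<lambda>g. density M (\<lambda>x. ennreal (max 0 (g x :: real))))"
  have v1: "pos_variation M (\<lambda>A. Re (\<nu> A)) = D (\<lambda>x. Re (h x))"
    unfolding D_def ennreal_max_0 using h hi[unfolded set_integrable_def]
    by (intro pos_variation_integral) (auto simp: \<nu> set_lebesgue_integral_def simp flip: integral_Re)
  have v2: "neg_variation M (\<lambda>A. Re (\<nu> A)) = D (\<lambda>x. - Re (h x))"
    unfolding D_def neg_variation_def ennreal_max_0 using h hi[unfolded set_integrable_def]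
    by (intro pos_variation_integral) (auto simp: \<nu> set_lebesgue_integral_def simp flip: integral_Re)
  have v3: "pos_variation M (\<lambda>A. Im (\<nu> A)) = D (\<lambda>x. Im (h x))"
    unfolding D_def ennreal_max_0 using h hi[unfolded set_integrable_def]
    by (intro pos_variation_integral) (auto simp: \<nu> set_lebesgue_integral_def simp flip: integral_Im)
  have v4: "neg_variation M (\<lambda>A. Im (\<nu> A)) = D (\<lambda>x. - Im (h x))"
    unfolding D_def neg_variation_def ennreal_max_0 using h hi[unfolded set_integrable_def]
    by (intro pos_variation_integral) (auto simp: \<nu> set_lebesgue_integral_def simp flip: integral_Im)
  have D: "integrable (D g) f \<and> integral\<^sup>L (D g) f = (LINT x|M. max 0 (g x) *\<^sub>R f x)
       \<and> integrable M (\<lambda>x. max 0 (g x) *\<^sub>R f x)"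
    if [measurable]: "g \<in> borel_measurable M" and b: "\<And>x. \<bar>g x\<bar> \<le> cmod (h x)" for g
  proof -
    have "integrable M (\<lambda>x. max 0 (g x) *\<^sub>R f x)"
    proof (rule Bochner_Integration.integrable_bound[OF fh])
      have "max 0 (g x) * cmod (f x) \<le> cmod (f x) * cmod (h x)" for x
        using b[of x] by (subst mult.commute, intro mult_left_mono) auto
      then show "AE x in M. cmod (max 0 (g x) *\<^sub>R f x) \<le> cmod (f x * h x)"
        by (simp add: norm_mult)
    qed measurable
    then show ?thesis unfolding D_def
      by (subst integrable_density, simp_all add: integral_density)
  qed
  note Ds = D[of "\<lambda>x. Re (h x)"] D[of "\<lambda>x. - Re (h x)"] D[of "\<lambda>x. Im (h x)"] D[of "\<lambda>x. - Im (h x)"]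
  show "cm_integrable M \<nu> f"
    unfolding cm_integrable_def v1 v2 v3 v4 using Ds abs_Re_le_cmod abs_Im_le_cmod by auto
  have split: "of_real (max 0 a) - of_real (max 0 (- a)) = (of_real a :: complex)" for a
    by (auto simp: max_def)
  have "cm_integral M \<nu> f = (LINT x|M. max 0 (Re (h x)) *\<^sub>R f x) - (LINT x|M. max 0 (- Re (h x)) *\<^sub>R f x)
     + \<i> * ((LINT x|M. max 0 (Im (h x)) *\<^sub>R f x) - (LINT x|M. max 0 (- Im (h x)) *\<^sub>R f x))"
    unfolding cm_integral_def v1 v2 v3 v4 using Ds abs_Re_le_cmod abs_Im_le_cmod by auto
  also have "\<dots> = (LINT x|M. (max 0 (Re (h x)) *\<^sub>R f x - max 0 (- Re (h x)) *\<^sub>R f x)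
     + \<i> * (max 0 (Im (h x)) *\<^sub>R f x - max 0 (- Im (h x)) *\<^sub>R f x))"
    using Ds abs_Re_le_cmod abs_Im_le_cmod by simp
  also have "\<dots> = (LINT x|M. f x * h x)"
  proof (rule Bochner_Integration.integral_cong[OF refl])
    fix x
    have "(max 0 (Re (h x)) *\<^sub>R f x - max 0 (- Re (h x)) *\<^sub>R f x)
     + \<i> * (max 0 (Im (h x)) *\<^sub>R f x - max 0 (- Im (h x)) *\<^sub>R f x)
      = ((of_real (max 0 (Re (h x))) - of_real (max 0 (- Re (h x))))
        + \<i> * (of_real (max 0 (Im (h x))) - of_real (max 0 (- Im (h x))))) * f x"
      by (simp add: scaleR_conv_of_real algebra_simps)
    also have "\<dots> = f x * h x"
      unfolding split by (simp flip: complex_eq)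
    finally show "(max 0 (Re (h x)) *\<^sub>R f x - max 0 (- Re (h x)) *\<^sub>R f x)
     + \<i> * (max 0 (Im (h x)) *\<^sub>R f x - max 0 (- Im (h x)) *\<^sub>R f x) = f x * h x" .
  qed
  finally show "cm_integral M \<nu> f = (LINT x|M. f x * h x)" .
qed

text \<open>Dominated convergence with majorant \<open>cmod h\<close>: for disjoint sets the partial
  sums of the indicators lie between 0 and 1 and converge to the indicator of the union.\<close>

lemma complex_measure_density:
  fixes h :: "'a \<Rightarrow> complex"
  assumes h: "integrable M h"
    and \<nu>: "\<And>A. A \<in> sets M \<Longrightarrow> \<nu> A = (LINT x:A|M. h x)"
  shows "complex_measure M \<nu>"
  unfolding complex_measure_def
proof (intro conjI allI impI)
  show "\<nu> {} = 0" using \<nu>[of "{}"] by (simp add: set_lebesgue_integral_def)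
  fix A :: "nat \<Rightarrow> 'a set"
  assume A: "range A \<subseteq> sets M" "disjoint_family A"
  have [measurable]: "h \<in> borel_measurable M" using h by auto
  have Am[measurable]: "A n \<in> sets M" for n using A by auto
  have ind: "(\<lambda>n. indicat_real (A n) x) sums indicator (\<Union>n. A n) x" for x
  proof (cases "x \<in> (\<Union>n. A n)")
    case True
    then obtain m where m: "x \<in> A m" by blast
    then have "indicat_real (A n) x = (if n = m then 1 else 0)" for n
      using A(2) by (auto simp: disjoint_family_on_def split: split_indicator)
    then show ?thesis using True sums_single[of m "\<lambda>_. 1::real"] by simp
  qed (auto simp: indicator_def)
  have "(\<lambda>N. LINT x|M. (\<Sum>n<N. indicat_real (A n) x) *\<^sub>R h x)
      \<longlonglongrightarrow> (LINT x|M. indicat_real (\<Union>n. A n) x *\<^sub>R h x)"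
  proof (rule integral_dominated_convergence[where w = "\<lambda>x. cmod (h x)"])
    show "AE x in M. (\<lambda>N. (\<Sum>n<N. indicat_real (A n) x) *\<^sub>R h x)
      \<longlonglongrightarrow> indicat_real (\<Union>n. A n) x *\<^sub>R h x"
      using ind by (intro AE_I2 tendsto_scaleR tendsto_const) (simp add: sums_def)
    have "\<bar>\<Sum>n<N. indicat_real (A n) x\<bar> \<le> 1" for N x
    proof -
      have "(\<Sum>n<N. indicat_real (A n) x) \<le> (\<Sum>n. indicat_real (A n) x)"
        using ind[of x] by (intro sum_le_suminf) (auto simp: sums_iff)
      also have "\<dots> \<le> 1" using ind[of x] by (simp add: sums_iff indicator_def)
      finally show ?thesis by (simp add: sum_nonneg)
    qed
    then show "AE x in M. cmod ((\<Sum>n<N. indicat_real (A n) x) *\<^sub>R h x) \<le> cmod (h x)" for N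
      by (simp add: mult_left_le_one_le)
  qed (use h in auto)
  moreover have "(LINT x|M. (\<Sum>n<N. indicat_real (A n) x) *\<^sub>R h x) = (\<Sum>n<N. \<nu> (A n))" for N
    using h unfolding scaleR_sum_left
    by (subst Bochner_Integration.integral_sum)
       (auto simp: \<nu> set_lebesgue_integral_def intro!: integrable_mult_indicator)
  ultimately show "(\<lambda>n. \<nu> (A n)) sums \<nu> (\<Union>n. A n)"
    by (simp add: sums_def \<nu> set_lebesgue_integral_def)
qed

section \<open>Algebra behind the generating functions and the weights\<close>

text \<open>With \<open>e\<close> read as the exponential of rate \<open>k\<close>, the brackets
  times \<open>e\<close> are the first and second derivatives of \<open>G * e\<close>. The choice
  \<open>b * k = 1\<close> removes the term \<open>X * G\<close>, the only one involving the
  preceding coefficient of a power series, so a three-term recurrence becomes a two-term one. It is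
  applied with \<open>k = 1 / \<beta>\<close> and \<open>l = 1 / \<alpha>\<close>.\<close>

lemma ode_shift:
  fixes G G1 G2 :: "'a::comm_ring_1"
  assumes "b * k = 1"
    and "x * G = s * G1 + a * b * X * G2 + (a + b) * X * G1 + s * l * G + X * G"
  shows "s * ((G1 + k * G) * e) + a * b * X * ((G2 + 2 * k * G1 + k * k * G) * e) =
    x * (G * e) + (a - b) * X * ((G1 + k * G) * e) + s * (k - l) * (G * e)"
proof -
  have "a * b * X * (G2 + 2 * k * G1 + k * k * G)
      = a * b * X * G2 + 2 * (b * k) * (a * X * G1) + (b * k) * (a * k * X * G)"
    by (simp add: algebra_simps)
  moreover have "(a - b) * X * (G1 + k * G) = (a - b) * X * G1 + a * k * X * G - (b * k) * X * G"
    by (simp add: algebra_simps)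
  ultimately have "s * (G1 + k * G) + a * b * X * (G2 + 2 * k * G1 + k * k * G) =
      x * G + (a - b) * X * (G1 + k * G) + s * (k - l) * G"
    unfolding assms by (simp add: algebra_simps)
  from arg_cong[OF this, of "\<lambda>t. t * e"] show ?thesis
    by (simp only: distrib_right mult.assoc)
qed

lemma gen_fact_pochhammer:
  assumes "\<eta> \<noteq> 0"
  shows "gen_fact \<sigma> (- \<eta>) n = \<eta> ^ n * pochhammer (\<sigma> / \<eta>) n"
proof -
  have "gen_fact \<sigma> (- \<eta>) n = (\<Prod>k<n. \<eta> * (\<sigma> / \<eta> + real k))"
    unfolding gen_fact_def using assms by (intro prod.cong) (auto simp: field_simps)
  then show ?thesis
    by (simp add: prod.distrib pochhammer_prod atLeast0LessThan)
qed

section \<open>Weights, rising products and their link to the Sheffer polynomials\<close>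

locale segal_bargmann_params =
  fixes \<alpha> \<beta> \<sigma> :: real
  assumes \<beta>_le_\<alpha>: "\<beta> \<le> \<alpha>" and \<beta>_pos: "\<beta> > 0" and \<sigma>_pos: "\<sigma> > 0"
begin

lemma \<alpha>_pos: "\<alpha> > 0" using \<beta>_le_\<alpha> \<beta>_pos by simp

text \<open>The squared norm of \<open>z ^ n\<close> in the Fock space, hence by unitarity also that
  of the \<open>n\<close>-th Sheffer polynomial.\<close>

definition weight :: "nat \<Rightarrow> real" where
  "weight n = fact n * gen_fact \<sigma> (- (\<alpha> * \<beta>)) n"

text \<open>For \<alpha> = \<beta> this is \<open>x ^ m\<close>; at the atom
  \<open>(\<alpha> - \<beta>) * n\<close> it is \<open>(\<alpha> - \<beta>) ^ m\<close> times the
  rising factorial of \<open>\<sigma> / (\<alpha> * \<beta>) + n\<close> of length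
  \<open>m\<close>.\<close>

definition rising :: "nat \<Rightarrow> real poly" where
  "rising m = (\<Prod>k<m. [:(\<alpha> - \<beta>) * (\<sigma> / (\<alpha> * \<beta>) + real k), 1:])"

lemma weight_0 [simp]: "weight 0 = 1"
  by (simp add: weight_def gen_fact_def)

lemma weight_Suc: "weight (Suc n) = (real n + 1) * (\<sigma> + \<alpha> * \<beta> * real n) * weight n"
  by (simp add: weight_def gen_fact_def algebra_simps)

lemma weight_pos: "weight n > 0"
  using \<alpha>_pos \<beta>_pos \<sigma>_pos by (induction n) (simp_all add: weight_Suc add_pos_nonneg)

lemma poly_rising_Suc:
  "poly (rising (Suc m)) x = (x + (\<alpha> - \<beta>) * (\<sigma> / (\<alpha> * \<beta>) + real m)) * poly (rising m) x"
  by (simp add: rising_def algebra_simps)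

lemma rising_0 [simp]: "rising 0 = 1"
  by (simp add: rising_def)

lemma rising_ge: "0 \<le> x \<Longrightarrow> x ^ m \<le> poly (rising m) x"
proof (induction m)
  case (Suc m)
  have "x * x ^ m \<le> (x + (\<alpha> - \<beta>) * (\<sigma> / (\<alpha> * \<beta>) + real m)) * poly (rising m) x"
    using Suc \<alpha>_pos \<beta>_pos \<sigma>_pos \<beta>_le_\<alpha> by (intro mult_mono) auto
  then show ?case by (simp add: poly_rising_Suc)
qed simp

lemma rising_nonneg: "0 \<le> x \<Longrightarrow> 0 \<le> poly (rising m) x"
  using rising_ge[of x m] zero_le_power[of x m] by linarith

text \<open>Both sides have generating functions solving
  \<open>x F = \<sigma> F' + \<eta> z F'' - (\<alpha> - \<beta>) z F' - \<sigma> (\<alpha> - \<beta>) / \<eta> F\<close>, the right one because of the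
  recurrence for \<^const>\<open>sheffer\<close>.\<close>

lemma rising_conv_sheffer:
  "poly (rising m) x / weight m =
     (\<Sum>n\<le>m. poly (sheffer \<alpha> \<beta> \<sigma> n) x / weight n * ((1 / \<beta>) ^ (m - n) / fact (m - n)))"
proof -
  define G where "G = Abs_fps (\<lambda>n. poly (sheffer \<alpha> \<beta> \<sigma> n) x / weight n)"
  define F where "F = G * fps_exp (1 / \<beta>)"
  have G: "x * fps_nth G n = (real n + 1) * (\<sigma> + \<alpha> * \<beta> * real n) * fps_nth G (Suc n)
        + ((\<alpha> + \<beta>) * real n + \<sigma> / \<alpha>) * fps_nth G n + (if n = 0 then 0 else fps_nth G (n - 1))" for n
  proof -
    have w: "weight k \<noteq> 0" for k using weight_pos[of k] by simp
    \<comment> \<open>The ratio of \<open>weight n\<close> to \<open>weight (n - 1)\<close> is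
      exactly this coefficient, so it cancels. For \<open>n = 0\<close> the coefficient vanishes,
      which makes the truncated \<open>n - 1\<close> harmless.\<close>
    have "(\<sigma> * real n + \<alpha> * \<beta> * real n * (real n - 1)) * poly (sheffer \<alpha> \<beta> \<sigma> (n - 1)) x / weight n
       = (if n = 0 then 0 else fps_nth G (n - 1))"
    proof (cases n)
      case (Suc k)
      have "(real k + 1) * (\<sigma> + \<alpha> * \<beta> * real k) \<noteq> 0" using w[of "Suc k"] by (auto simp: weight_Suc)
      then show ?thesis using Suc w[of k]
        by (simp add: G_def weight_Suc divide_simps) (simp add: algebra_simps)
    qed simp
    moreover have "poly (sheffer \<alpha> \<beta> \<sigma> (Suc n)) x / weight n = (real n + 1) * (\<sigma> + \<alpha> * \<beta> * real n) * fps_nth G (Suc n)"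
      using w[of "Suc n"] by (simp add: G_def weight_Suc divide_simps)
    moreover have "x * poly (sheffer \<alpha> \<beta> \<sigma> n) x / weight n = poly (sheffer \<alpha> \<beta> \<sigma> (Suc n)) x / weight n
     + ((\<alpha> + \<beta>) * real n + \<sigma> / \<alpha>) * (poly (sheffer \<alpha> \<beta> \<sigma> n) x / weight n)
     + (\<sigma> * real n + \<alpha> * \<beta> * real n * (real n - 1)) * poly (sheffer \<alpha> \<beta> \<sigma> (n - 1)) x / weight n"
      unfolding sheffer_recurrence[of x \<alpha> \<beta> \<sigma> n] by (simp add: add_divide_distrib)
    ultimately show ?thesis by (simp add: G_def)
  qed
  \<comment> \<open>The recurrence as a differential equation: multiplication by \<open>n\<close>
    becomes \<open>fps_X\<close> times the derivative, and the shift to \<open>n - 1\<close> becomes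
    multiplication by \<open>fps_X\<close>.\<close>
  have ode_G: "fps_const x * G = fps_const \<sigma> * fps_deriv G + fps_const (\<alpha> * \<beta>) * fps_X * fps_deriv (fps_deriv G)
      + fps_const (\<alpha> + \<beta>) * fps_X * fps_deriv G + fps_const (\<sigma> / \<alpha>) * G + fps_X * G"
    by (rule fps_ext, subst fps_mult_left_const_nth, subst G)
       (auto simp: mult.assoc algebra_simps simp del: of_nat_Suc split: nat.splits; simp add: algebra_simps)
  define e where "e = fps_exp (1 / \<beta>)"
  have e: "fps_deriv e = fps_const (1 / \<beta>) * e" by (simp add: e_def)
  \<comment> \<open>The exponential factor eliminates the coefficient of index \<open>m - 1\<close>;
    what remains is the recursion satisfied by \<open>poly (rising m) x / weight m\<close>.\<close>
  have F_nth: "(real m + 1) * (\<sigma> + \<alpha> * \<beta> * real m) * fps_nth F (Suc m) =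
      (x + (\<alpha> - \<beta>) * (\<sigma> / (\<alpha> * \<beta>) + real m)) * fps_nth F m" for m
  proof -
    have F: "F = G * e" by (simp add: F_def e_def)
    have F1: "fps_deriv F = (fps_deriv G + fps_const (1 / \<beta>) * G) * e"
      by (simp add: F e algebra_simps)
    have F2: "fps_deriv (fps_deriv F) = (fps_deriv (fps_deriv G) + 2 * fps_const (1 / \<beta>) * fps_deriv G
           + fps_const (1 / \<beta>) * fps_const (1 / \<beta>) * G) * e"
      by (simp add: F1 e algebra_simps del: fps_const_mult)
    have "fps_const \<sigma> * fps_deriv F + fps_const \<alpha> * fps_const \<beta> * fps_X * fps_deriv (fps_deriv F)
      = fps_const x * F + (fps_const \<alpha> - fps_const \<beta>) * fps_X * fps_deriv F
        + fps_const \<sigma> * (fps_const (1 / \<beta>) - fps_const (1 / \<alpha>)) * F"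
      unfolding F2 unfolding F1 unfolding F using \<beta>_pos ode_G
      by (intro ode_shift) simp_all
    from arg_cong[OF this, of "\<lambda>f. fps_nth f m"] show ?thesis using \<alpha>_pos \<beta>_pos
      by (cases m) (simp_all add: mult.assoc field_simps)
  qed
  have "fps_nth F m = poly (rising m) x / weight m"
  proof (induction m)
    case 0
    then show ?case by (simp add: F_def G_def)
  next
    case (Suc m)
    have "(real m + 1) * (\<sigma> + \<alpha> * \<beta> * real m) \<noteq> 0" using weight_pos[of "Suc m"] by (auto simp: weight_Suc)
    then have "fps_nth F (Suc m) = (x + (\<alpha> - \<beta>) * (\<sigma> / (\<alpha> * \<beta>) + real m)) * fps_nth F m
        / ((real m + 1) * (\<sigma> + \<alpha> * \<beta> * real m))"
      using F_nth[of m] by (simp add: field_simps)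
    then show ?case by (simp add: Suc poly_rising_Suc weight_Suc)
  qed
  moreover have "fps_nth F m = (\<Sum>n\<le>m. poly (sheffer \<alpha> \<beta> \<sigma> n) x / weight n * ((1 / \<beta>) ^ (m - n) / fact (m - n)))"
    by (simp add: F_def G_def fps_mult_nth atLeast0AtMost)
  ultimately show ?thesis by simp
qed

section \<open>The measures \<open>mu\<close>: finiteness, change of parameter, moments\<close>

lemma space_mu_nonneg: "x \<in> space (mu \<alpha> \<beta> \<sigma>) \<Longrightarrow> 0 \<le> x"
  using \<beta>_le_\<alpha> by (auto simp: space_mu carrier_X_def split: if_splits)

lemma measurable_mu_continuous:
  fixes f :: "real \<Rightarrow> 'b::topological_space"
  assumes "continuous_on UNIV f"
  shows "f \<in> borel_measurable (mu \<alpha> \<beta> \<sigma>)"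
proof (cases "\<alpha> = \<beta>")
  case True
  then have "sets (mu \<alpha> \<beta> \<sigma>) = sets (restrict_space borel {0<..})"
    by (simp add: mu_def carrier_X_def sets_restrict_space)
  moreover have "f \<in> borel_measurable (restrict_space borel {0<..})"
    using assms by (intro measurable_restrict_space1 borel_measurable_continuous_onI)
  ultimately show ?thesis by (simp cong: measurable_cong_sets)
next
  case False
  then have "sets (mu \<alpha> \<beta> \<sigma>) = sets (count_space (carrier_X \<alpha> \<beta>))"
    by (simp add: mu_def)
  from measurable_cong_sets[OF this refl, of "borel :: 'b measure"] show ?thesis by simp
qed

lemma poly_measurable [measurable]: "poly p \<in> borel_measurable (mu \<alpha> \<beta> \<sigma>)"
  by (intro measurable_mu_continuous continuous_intros)

text \<open>The mass is Euler's Gamma integral if \<alpha> = \<beta> and a negative binomial series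
  otherwise. Used for shifted parameters, this later makes polynomials integrable.\<close>

lemma finite_mu: "emeasure (mu \<alpha> \<beta> \<sigma>) (space (mu \<alpha> \<beta> \<sigma>)) < \<infinity>"
proof (cases "\<alpha> = \<beta>")
  case True
  define a where "a = \<sigma> / (\<alpha> * \<beta>)"
  have a: "a > 0" using \<alpha>_pos \<beta>_pos \<sigma>_pos by (simp add: a_def)
  define C where "C = 1 / Gamma a * \<alpha> powr (- \<sigma> / (\<alpha> * \<beta>))"
  define g where "g = (\<lambda>x. indicator {0<..} x * (x powr (- 1 + a) * exp (- x / \<alpha>)))"
  \<comment> \<open>The norm of Euler's complex integrand at the real exponent \<open>a\<close> is
    the density of the measure up to the constant \<open>C\<close>.\<close>
  have "(\<lambda>t. complex_of_real t powr (of_real a - 1) / of_real (exp (1 / \<alpha> * t))) absolutely_integrable_on {0<..}"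
    using a \<alpha>_pos by (intro absolutely_integrable_Gamma_integral) auto
  then have "integrable lebesgue (\<lambda>t. norm (indicator {0<..} t *\<^sub>R (complex_of_real t powr (of_real a - 1) / of_real (exp (1 / \<alpha> * t)))))"
    unfolding set_integrable_def by (rule integrable_norm)
  also have "(\<lambda>t. norm (indicator {0<..} t *\<^sub>R (complex_of_real t powr (of_real a - 1) / of_real (exp (1 / \<alpha> * t))))) = g"
    by (auto simp: fun_eq_iff g_def norm_divide norm_powr_real_powr exp_minus field_simps split: split_indicator)
  finally have g: "integrable lborel g"
    by (subst (asm) integrable_completion) (auto simp: g_def)
  have "emeasure (mu \<alpha> \<beta> \<sigma>) (space (mu \<alpha> \<beta> \<sigma>)) = (\<integral>\<^sup>+x. ennreal (C * g x) \<partial>lborel)"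
  proof -
    let ?R = "restrict_space lborel {0 :: real<..}"
    let ?w = "\<lambda>x. 1 / Gamma (\<sigma> / (\<alpha> * \<beta>)) * \<alpha> powr (- \<sigma> / (\<alpha> * \<beta>)) * x powr (- 1 + \<sigma> / (\<alpha> * \<beta>)) * exp (- x / \<alpha>)"
    have "emeasure (mu \<alpha> \<beta> \<sigma>) (space (mu \<alpha> \<beta> \<sigma>)) = emeasure (density ?R (\<lambda>x. ennreal (?w x))) (space ?R)"
      using True by (simp add: mu_def carrier_X_def)
    also have "\<dots> = (\<integral>\<^sup>+x. ennreal (?w x) * indicator (space ?R) x \<partial>?R)"
      by (intro emeasure_density sets.top measurable_restrict_space1) measurable
    also have "\<dots> = (\<integral>\<^sup>+x. ennreal (?w x) \<partial>?R)"
      by (intro nn_integral_cong) auto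
    also have "\<dots> = (\<integral>\<^sup>+x. ennreal (C * g x) \<partial>lborel)"
      by (subst nn_integral_restrict_space)
         (auto intro!: nn_integral_cong simp: C_def g_def a_def mult.assoc split: split_indicator)
    finally show ?thesis .
  qed
  also have "\<dots> < \<infinity>"
    using integrableD(2)[OF integrable_mult_right[OF g, of C]] a \<alpha>_pos
    by (simp add: C_def g_def Gamma_real_pos less_top)
  finally show ?thesis .
next
  case False
  then have lt: "\<beta> < \<alpha>" using \<beta>_le_\<alpha> by simp
  define a where "a = \<sigma> / (\<alpha> * \<beta>)"
  have a: "a > 0" using \<alpha>_pos \<beta>_pos \<sigma>_pos by (simp add: a_def)
  define C where "C = (1 - \<beta> / \<alpha>) powr a"
  \<comment> \<open>Newton's series for \<open>(1 - \<beta> / \<alpha>) powr (- a)\<close>,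
    convergent since \<beta> < \<alpha>. The signs of the generalized binomial coefficient and of
    the power cancel.\<close>
  have "(\<lambda>n. ((- a) gchoose n) * (- (\<beta> / \<alpha>)) ^ n) sums (1 + (- (\<beta> / \<alpha>))) powr (- a)"
    using lt \<alpha>_pos \<beta>_pos by (intro gen_binomial_real) simp
  also have "(\<lambda>n. ((- a) gchoose n) * (- (\<beta> / \<alpha>)) ^ n) = (\<lambda>n. (\<beta> / \<alpha>) ^ n * (1 / fact n * pochhammer a n))"
    by (auto simp: fun_eq_iff gbinomial_pochhammer power_minus')
  finally have s: "summable (\<lambda>n. C * ((\<beta> / \<alpha>) ^ n * (1 / fact n) * pochhammer a n))"
    by (intro summable_mult) (auto simp: sums_iff mult.assoc)
  have pos: "0 \<le> C * ((\<beta> / \<alpha>) ^ n * (1 / fact n) * pochhammer a n)" for n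
    using \<alpha>_pos \<beta>_pos less_imp_le[OF pochhammer_pos[OF a]] unfolding C_def
    by (intro mult_nonneg_nonneg divide_nonneg_nonneg zero_le_power powr_ge_zero) auto
  have "emeasure (mu \<alpha> \<beta> \<sigma>) (space (mu \<alpha> \<beta> \<sigma>)) = (\<integral>\<^sup>+n. ennreal (C * ((\<beta> / \<alpha>) ^ n * (1 / fact n) * pochhammer a n)) \<partial>count_space UNIV)"
    using False
    by (subst space_mu, simp add: mu_def carrier_X_def emeasure_distr emeasure_density C_def a_def vimage_def)
  also have "\<dots> < \<infinity>"
    using s pos by (simp add: nn_integral_count_space_nat ennreal_suminf_neq_top less_top)
  finally show ?thesis .
qed

text \<open>The new parameter raises \<open>a = \<sigma> / (\<alpha> * \<beta>)\<close> by
  \<open>m\<close>. The densities are compared pointwise: the functional equation of Gamma supplies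
  the constant for \<alpha> = \<beta>, and regrouped rising factorials supply it for \<alpha> >
  \<beta>.\<close>

lemma mu_shift:
  "mu \<alpha> \<beta> (\<alpha> * \<beta> * real m + \<sigma>) =
    density (mu \<alpha> \<beta> \<sigma>) (\<lambda>x. ennreal (fact m * \<beta> ^ m * (poly (rising m) x / weight m)))"
proof -
  define a where "a = \<sigma> / (\<alpha> * \<beta>)"
  have a: "a > 0" using \<alpha>_pos \<beta>_pos \<sigma>_pos by (simp add: a_def)
  have am: "(\<alpha> * \<beta> * real m + \<sigma>) / (\<alpha> * \<beta>) = a + real m"
    using \<alpha>_pos \<beta>_pos by (simp add: a_def field_simps)
  have am': "(- (\<alpha> * \<beta> * real m + \<sigma>)) / (\<alpha> * \<beta>) = - a - real m"
    using \<alpha>_pos \<beta>_pos by (simp add: a_def field_simps)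
  have a': "- \<sigma> / (\<alpha> * \<beta>) = - a" by (simp add: a_def)
  have p: "pochhammer a n > 0" for n using a by (rule pochhammer_pos)
  \<comment> \<open>As \<open>weight m\<close> is \<open>fact m * (\<alpha> * \<beta>) ^ m\<close>
    times the rising factorial of \<open>a\<close>, only \<open>\<alpha> ^ m\<close> and that rising
    factorial survive in the denominator.\<close>
  have d: "fact m * \<beta> ^ m * (poly (rising m) x / weight m) = poly (rising m) x / \<alpha> ^ m / pochhammer a m" for x
    using \<alpha>_pos \<beta>_pos p[of m] by (simp add: weight_def gen_fact_pochhammer a_def field_simps)
  show ?thesis
  proof (cases "\<alpha> = \<beta>")
    case True
    let ?w = "\<lambda>x. 1 / Gamma a * \<alpha> powr - a * x powr (- 1 + a) * exp (- x / \<alpha>)"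
    have r: "poly (rising m) x = x ^ m" for x
      by (induction m) (simp_all add: poly_rising_Suc, simp add: True)
    have G: "Gamma (a + real m) = pochhammer a m * Gamma a"
    proof -
      have "a \<notin> \<int>\<^sub>\<le>\<^sub>0" using a nonpos_Ints_nonpos[of a] by auto
      then show ?thesis using pochhammer_Gamma[of a m] Gamma_real_pos[OF a] by simp
    qed
    have *: "1 / Gamma (a + real m) * \<alpha> powr (- a - real m) * x powr (- 1 + (a + real m)) * exp (- x / \<alpha>)
       = ?w x * (x ^ m / \<alpha> ^ m / pochhammer a m)" if "x > 0" for x
      using that \<alpha>_pos by (simp add: G powr_diff powr_add powr_realpow field_simps)
    have "density (mu \<alpha> \<beta> \<sigma>) (\<lambda>x. ennreal (poly (rising m) x / \<alpha> ^ m / pochhammer a m))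
       = density (restrict_space lborel (carrier_X \<alpha> \<beta>)) (\<lambda>x. ennreal (?w x) * ennreal (x ^ m / \<alpha> ^ m / pochhammer a m))"
      unfolding mu_def r a' a_def[symmetric] if_P[OF True]
      by (intro density_density_eq measurable_restrict_space1) measurable
    also have "\<dots> = mu \<alpha> \<beta> (\<alpha> * \<beta> * real m + \<sigma>)"
      unfolding mu_def am am' if_P[OF True]
    proof (intro density_cong AE_I2)
      fix x assume "x \<in> space (restrict_space lborel (carrier_X \<alpha> \<beta>))"
      then have x: "x > 0" using True by (simp add: space_restrict_space carrier_X_def)
      show "ennreal (?w x) * ennreal (x ^ m / \<alpha> ^ m / pochhammer a m) = ennreal (1 / Gamma (a + real m) * \<alpha> powr (- a - real m) * x powr (- 1 + (a + real m)) * exp (- x / \<alpha>))"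
        unfolding *[OF x] using x a \<alpha>_pos p[of m] Gamma_real_pos[of a]
        by (intro ennreal_mult[symmetric]) auto
    qed (intro measurable_restrict_space1, measurable)+
    finally show ?thesis unfolding d by (rule sym)
  next
    case False
    then have lt: "\<beta> < \<alpha>" using \<beta>_le_\<alpha> by simp
    let ?w = "\<lambda>n. (1 - \<beta> / \<alpha>) powr a * ((\<beta> / \<alpha>) ^ n * (1 / fact n) * pochhammer a n)"
    let ?r = "\<lambda>x. poly (rising m) x / \<alpha> ^ m / pochhammer a m"
    have r: "poly (rising m) ((\<alpha> - \<beta>) * real n) = (\<alpha> - \<beta>) ^ m * pochhammer (a + real n) m" for n
      by (induction m) (simp_all add: poly_rising_Suc pochhammer_Suc a_def algebra_simps)
    \<comment> \<open>Both sides are the rising factorial of \<open>a\<close> of length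
      \<open>m + n\<close>, split after \<open>m\<close> and after \<open>n\<close> factors.\<close>
    have "pochhammer a m * pochhammer (a + real m) n = pochhammer a n * pochhammer (a + real n) m" for n
      by (metis pochhammer_product' add.commute)
    then have c: "pochhammer (a + real m) n = pochhammer a n * pochhammer (a + real n) m / pochhammer a m" for n
      using p[of m] by (simp add: field_simps)
    \<comment> \<open>The additional exponent \<open>m\<close> yields
      \<open>((\<alpha> - \<beta>) / \<alpha>) ^ m\<close>, which accounts for the factor
      \<open>(\<alpha> - \<beta>) ^ m\<close> of \<open>rising m\<close> at the atoms.\<close>
    have q: "(1 - \<beta> / \<alpha>) powr (a + real m) = (1 - \<beta> / \<alpha>) powr a * ((\<alpha> - \<beta>) ^ m / \<alpha> ^ m)"
      using lt \<alpha>_pos by (simp add: powr_add powr_realpow flip: power_divide) (simp add: field_simps)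
    have *: "(1 - \<beta> / \<alpha>) powr (a + real m) * ((\<beta> / \<alpha>) ^ n * (1 / fact n) * pochhammer (a + real m) n)
       = ?w n * ?r ((\<alpha> - \<beta>) * real n)" for n
      unfolding q r c by (simp add: field_simps)
    have "density (mu \<alpha> \<beta> \<sigma>) (\<lambda>x. ennreal (?r x)) =
       distr (density (density (count_space UNIV) (\<lambda>n. ennreal (?w n))) (\<lambda>n. ennreal (?r ((\<alpha> - \<beta>) * real n)))) (count_space (carrier_X \<alpha> \<beta>)) (\<lambda>n. (\<alpha> - \<beta>) * real n)"
      unfolding mu_def if_not_P[OF False] a_def[symmetric]
      using False by (intro density_distr) (auto simp: carrier_X_def)
    also have "density (density (count_space UNIV) (\<lambda>n. ennreal (?w n))) (\<lambda>n. ennreal (?r ((\<alpha> - \<beta>) * real n)))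
       = density (count_space UNIV) (\<lambda>n. ennreal (?w n) * ennreal (?r ((\<alpha> - \<beta>) * real n)))"
      by (rule density_density_eq) auto
    also have "\<dots> = density (count_space UNIV) (\<lambda>n. ennreal ((1 - \<beta> / \<alpha>) powr (a + real m) * ((\<beta> / \<alpha>) ^ n * (1 / fact n) * pochhammer (a + real m) n)))"
      unfolding * using lt \<alpha>_pos \<beta>_pos p[of m] p rising_nonneg
      by (intro density_cong AE_I2 ennreal_mult[symmetric]) (auto intro!: mult_nonneg_nonneg divide_nonneg_nonneg less_imp_le[OF p])
    finally show ?thesis unfolding d by (simp add: mu_def False am)
  qed
qed

text \<open>\<open>rising m\<close> is a positive multiple of the density of the measure with
  shifted parameter, whose mass is finite by \<open>finite_mu\<close>.\<close>

lemma integrable_rising: "integrable (mu \<alpha> \<beta> \<sigma>) (poly (rising m))"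
proof -
  let ?d = "\<lambda>x. fact m * \<beta> ^ m * (poly (rising m) x / weight m)"
  have "\<alpha> * \<beta> * real m + \<sigma> > 0" using \<alpha>_pos \<beta>_pos \<sigma>_pos by (intro add_nonneg_pos) auto
  then interpret shift: segal_bargmann_params \<alpha> \<beta> "\<alpha> * \<beta> * real m + \<sigma>"
    using \<beta>_le_\<alpha> \<beta>_pos by unfold_locales
  have "integrable (mu \<alpha> \<beta> \<sigma>) ?d"
  proof (rule integrableI_nonneg)
    show "AE x in mu \<alpha> \<beta> \<sigma>. 0 \<le> ?d x"
      using rising_nonneg[OF space_mu_nonneg] \<beta>_pos weight_pos[of m] by (intro AE_I2) auto
    have "(\<integral>\<^sup>+x. ennreal (?d x) \<partial>mu \<alpha> \<beta> \<sigma>) = (\<integral>\<^sup>+x. ennreal (?d x) * indicator (space (mu \<alpha> \<beta> \<sigma>)) x \<partial>mu \<alpha> \<beta> \<sigma>)"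
      by (intro nn_integral_cong) auto
    then show "(\<integral>\<^sup>+x. ennreal (?d x) \<partial>mu \<alpha> \<beta> \<sigma>) < \<infinity>"
      using shift.finite_mu unfolding mu_shift by (simp add: emeasure_density)
  qed measurable
  then have "integrable (mu \<alpha> \<beta> \<sigma>) (\<lambda>x. (weight m / (fact m * \<beta> ^ m)) * ?d x)"
    by (rule integrable_mult_right)
  then show ?thesis using weight_pos[of m] \<beta>_pos by simp
qed

text \<open>By \<open>rising_ge\<close> each monomial is dominated on the carrier by the integrable
  \<open>rising m\<close>.\<close>

lemma integrable_poly: "integrable (mu \<alpha> \<beta> \<sigma>) (poly p)"
proof -
  have "integrable (mu \<alpha> \<beta> \<sigma>) (\<lambda>x. x ^ m)" for m
  proof (rule Bochner_Integration.integrable_bound[OF integrable_rising[of m]])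
    show "AE x in mu \<alpha> \<beta> \<sigma>. norm (x ^ m) \<le> norm (poly (rising m) x)"
      using rising_ge rising_nonneg space_mu_nonneg by (intro AE_I2) simp
  qed (intro measurable_mu_continuous continuous_intros)
  then show ?thesis
    by (subst poly_altdef[abs_def]) (auto intro!: Bochner_Integration.integrable_sum integrable_mult_right)
qed

end

section \<open>Square-integrable functions, the kernel and growth estimates\<close>

lemma taylor_coeff_power: "taylor_coeff (\<lambda>z. z ^ n) m = (if m = n then 1 else 0)"
proof -
  have "pochhammer (1 :: complex) n \<noteq> 0" by (simp flip: pochhammer_fact)
  moreover have "(deriv ^^ m) (\<lambda>w::complex. (w - 0) ^ n) 0 = pochhammer (of_nat (Suc n - m)) m * (0 - 0) ^ (n - m)"
    by (rule higher_deriv_power)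
  ultimately show ?thesis
    by (cases m n rule: linorder_cases) (auto simp: taylor_coeff_def pochhammer_0_left pochhammer_fact)
qed

lemma exp_series_complex: "\<zeta> ^ n /\<^sub>R fact n = (\<zeta> ^ n / fact n :: complex)"
  by (simp add: scaleR_conv_of_real divide_inverse mult.commute)

context segal_bargmann_params
begin

lemma integrable_poly_square: "integrable (mu \<alpha> \<beta> \<sigma>) (\<lambda>x. (poly p x)\<^sup>2)"
  using integrable_poly[of "p ^ 2"] by (simp add: poly_power[abs_def])

lemma poly_in_L2: "(\<lambda>x. complex_of_real (poly p x)) \<in> L2 (mu \<alpha> \<beta> \<sigma>)"
  using integrable_poly_square[of p] by (simp add: L2_def)

text \<open>Through this, the results on integrals of \<open>f\<close> against the kernel also apply
  to the values of \<open>rho\<close> on sets.\<close>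

lemma indicator_in_L2:
  assumes [measurable]: "A \<in> sets (mu \<alpha> \<beta> \<sigma>)"
  shows "(\<lambda>x. of_real (indicator A x)) \<in> L2 (mu \<alpha> \<beta> \<sigma>)"
proof -
  have "integrable (mu \<alpha> \<beta> \<sigma>) (\<lambda>x. 1 :: real)"
    using integrable_poly[of 1] by (simp add: poly_1[abs_def])
  then have "integrable (mu \<alpha> \<beta> \<sigma>) (\<lambda>x. indicat_real A x *\<^sub>R (1::real))"
    by (intro integrable_mult_indicator assms)
  moreover have "(\<lambda>x. (cmod (of_real (indicat_real A x)))\<^sup>2) = (\<lambda>x. indicat_real A x *\<^sub>R (1::real))"
    by (auto split: split_indicator)
  ultimately show ?thesis unfolding L2_def by auto
qed

text \<open>This is the density \<open>k_z\<close>; for \<open>x \<ge> 0\<close> the series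
  converges absolutely by \<open>summable_kernel\<close>.\<close>

definition kernel :: "complex \<Rightarrow> real \<Rightarrow> complex" where
  "kernel z x = exp (- z / of_real \<beta>) * (\<Sum>m. z ^ m * of_real (poly (rising m) x / weight m))"

lemma weight_ge: "fact n * \<sigma> ^ n \<le> weight n"
proof (induction n)
  case (Suc n)
  have "(real n + 1) * \<sigma> * (fact n * \<sigma> ^ n) \<le> (real n + 1) * (\<sigma> + \<alpha> * \<beta> * real n) * weight n"
    using Suc \<alpha>_pos \<beta>_pos \<sigma>_pos by (intro mult_mono) auto
  then show ?case by (simp add: weight_Suc algebra_simps)
qed simp

text \<open>The inverse square root arises when integrals against the \<open>n\<close>-th Sheffer
  polynomial are bounded by a multiple of \<open>sqrt (weight n)\<close> and divided by
  \<open>weight n\<close>. By \<open>weight_ge\<close> the weights grow fast enough for every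
  \<open>r\<close>.\<close>

lemma summable_inverse_sqrt_weight: "summable (\<lambda>n. r ^ n / sqrt (weight n))"
proof (rule summable_comparison_test')
  have "summable (\<lambda>n. (4 * r\<^sup>2 / \<sigma>) ^ n / fact n)"
    using summable_exp[of "4 * r\<^sup>2 / \<sigma>"] by (simp only: divide_inverse mult.commute)
  then show "summable (\<lambda>n. ((1 / 4) ^ n + (4 * r\<^sup>2 / \<sigma>) ^ n / fact n) / 2)"
    by (intro summable_divide summable_add summable_geometric) simp_all
  fix n :: nat
  \<comment> \<open>Expanding the square gives an AM-GM bound. The factor \<open>1 / 2\<close> is
    split off so that one resulting series is geometric and the other exponential.\<close>
  have "0 \<le> ((1 / 2) ^ n - (2 * \<bar>r\<bar>) ^ n / sqrt (weight n))\<^sup>2" by simp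
  also have "\<dots> = (1 / 4) ^ n + (4 * r\<^sup>2) ^ n / weight n - 2 * (((1 / 2) ^ n * (2 * \<bar>r\<bar>) ^ n) / sqrt (weight n))"
  proof -
    have "((1 / 2) ^ n)\<^sup>2 = (1 / 4 :: real) ^ n"
      by (simp add: power2_eq_square flip: power_mult_distrib)
    moreover have "((2 * \<bar>r\<bar>) ^ n)\<^sup>2 = (4 * r\<^sup>2) ^ n"
      using power_even_eq[of "2 * \<bar>r\<bar>" n] power_mult[of "2 * \<bar>r\<bar>" 2 n] by (simp add: power_mult_distrib)
    ultimately show ?thesis
      using less_imp_le[OF weight_pos[of n]] by (simp add: power2_diff power_divide)
  qed
  also have "(1 / 2) ^ n * (2 * \<bar>r\<bar>) ^ n = \<bar>r\<bar> ^ n"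
    by (subst power_mult_distrib[symmetric]) simp
  also have "(4 * r\<^sup>2) ^ n / weight n \<le> (4 * r\<^sup>2) ^ n / (fact n * \<sigma> ^ n)"
    using weight_ge[of n] \<sigma>_pos by (intro divide_left_mono) (auto simp: weight_pos)
  finally show "norm (r ^ n / sqrt (weight n)) \<le> ((1 / 4) ^ n + (4 * r\<^sup>2 / \<sigma>) ^ n / fact n) / 2"
    using weight_pos[of n] by (simp add: power_abs power_divide mult.commute)
qed

text \<open>The ratio of consecutive terms is \<open>1 / (m + 1)\<close> times a quotient of two
  affine functions of \<open>m\<close>, which stays bounded.\<close>

lemma rising_le:
  assumes "0 \<le> x"
  obtains K where "\<And>m. poly (rising m) x / weight m \<le> K ^ m / fact m"
proof
  \<comment> \<open>The value of that quotient at \<open>m = 0\<close> plus the quotient of the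
    slopes; since all coefficients are nonnegative, this sum bounds it for every
    \<open>m\<close>.\<close>
  define K where "K = (x + (\<alpha> - \<beta>) * (\<sigma> / (\<alpha> * \<beta>))) / \<sigma> + (\<alpha> - \<beta>) / (\<alpha> * \<beta>)"
  show "poly (rising m) x / weight m \<le> K ^ m / fact m" for m
  proof (induction m)
    case (Suc m)
    have K: "K \<ge> 0" unfolding K_def
      using assms(1) \<alpha>_pos \<beta>_pos \<sigma>_pos \<beta>_le_\<alpha> by (intro add_nonneg_nonneg divide_nonneg_nonneg mult_nonneg_nonneg) auto
    let ?c = "\<sigma> + \<alpha> * \<beta> * real m"
    have c: "?c > 0" using \<alpha>_pos \<beta>_pos \<sigma>_pos by (simp add: add_pos_nonneg)
    have "x + (\<alpha> - \<beta>) * (\<sigma> / (\<alpha> * \<beta>) + real m) = (x + (\<alpha> - \<beta>) * (\<sigma> / (\<alpha> * \<beta>))) / \<sigma> * \<sigma> + (\<alpha> - \<beta>) / (\<alpha> * \<beta>) * (\<alpha> * \<beta> * real m)"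
      using \<alpha>_pos \<beta>_pos \<sigma>_pos by (simp add: field_simps)
    also have "\<dots> \<le> K * \<sigma> + K * (\<alpha> * \<beta> * real m)"
      unfolding K_def using assms(1) \<alpha>_pos \<beta>_pos \<sigma>_pos \<beta>_le_\<alpha>
      by (intro add_mono mult_right_mono) auto
    finally have "x + (\<alpha> - \<beta>) * (\<sigma> / (\<alpha> * \<beta>) + real m) \<le> K * ?c" by (simp add: algebra_simps)
    then have "(x + (\<alpha> - \<beta>) * (\<sigma> / (\<alpha> * \<beta>) + real m)) / ?c \<le> K"
      using c by (simp add: divide_le_eq)
    then have "(x + (\<alpha> - \<beta>) * (\<sigma> / (\<alpha> * \<beta>) + real m)) / ?c * (poly (rising m) x / weight m) \<le> K * (K ^ m / fact m)"
      using Suc K rising_nonneg[OF assms(1)] weight_pos[of m] by (intro mult_mono) auto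
    then have "(x + (\<alpha> - \<beta>) * (\<sigma> / (\<alpha> * \<beta>) + real m)) / ?c * (poly (rising m) x / weight m) / (real m + 1) \<le> K * (K ^ m / fact m) / (real m + 1)"
      by (intro divide_right_mono) auto
    then show ?case by (simp add: poly_rising_Suc weight_Suc mult_ac add.commute)
  qed simp
qed

lemma summable_kernel:
  assumes "0 \<le> x"
  shows "summable (\<lambda>m. norm (z ^ m * complex_of_real (poly (rising m) x / weight m)))"
proof -
  obtain K where K: "\<And>m. poly (rising m) x / weight m \<le> K ^ m / fact m"
    using rising_le[OF assms] by blast
  show ?thesis
  proof (rule summable_comparison_test')
    show "summable (\<lambda>m. (cmod z * K) ^ m /\<^sub>R fact m)"
      by (rule summable_exp_generic)
    show "norm (norm (z ^ m * complex_of_real (poly (rising m) x / weight m))) \<le> (cmod z * K) ^ m /\<^sub>R fact m" for m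
      using mult_left_mono[OF K[of m], of "cmod z ^ m"] rising_nonneg[OF assms, of m] weight_pos[of m]
      by (simp add: norm_mult norm_power norm_divide power_mult_distrib field_simps)
  qed
qed

end

section \<open>Taylor coefficients of the transform\<close>

locale segal_bargmann_transform = segal_bargmann_params +
  fixes S :: "(real \<Rightarrow> complex) \<Rightarrow> (complex \<Rightarrow> complex)"
  assumes S: "is_segal_bargmann \<alpha> \<beta> \<sigma> S"
begin

lemma S_sheffer: "S (\<lambda>x. of_real (poly (sheffer \<alpha> \<beta> \<sigma> n) x)) = (\<lambda>z. z ^ n)"
  using S by (auto simp: is_segal_bargmann_def)

text \<open>Unitarity turns the integral into a Fock inner product with \<open>z ^ n\<close>, in
  which a single coefficient survives. The polynomial is real, so the conjugation in
  \<open>L2_inner\<close> disappears.\<close>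

lemma integral_sheffer:
  assumes "f \<in> L2 (mu \<alpha> \<beta> \<sigma>)"
  shows "(LINT x|mu \<alpha> \<beta> \<sigma>. f x * of_real (poly (sheffer \<alpha> \<beta> \<sigma> n) x)) = taylor_coeff (S f) n * of_real (weight n)"
proof -
  let ?s = "\<lambda>x. complex_of_real (poly (sheffer \<alpha> \<beta> \<sigma> n) x)"
  have "fock_inner (\<alpha> * \<beta>) \<sigma> (S f) (S ?s) = L2_inner (mu \<alpha> \<beta> \<sigma>) f ?s"
    using S assms poly_in_L2 unfolding is_segal_bargmann_def is_unitary_def by blast
  moreover have "(\<lambda>k. taylor_coeff (S f) k * cnj (taylor_coeff (S ?s) k) * of_real (weight k))
      = (\<lambda>k. if k = n then taylor_coeff (S f) k * of_real (weight k) else 0)"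
    by (auto simp: S_sheffer taylor_coeff_power)
  ultimately show ?thesis
    unfolding fock_inner_def weight_def[symmetric] L2_inner_def
    using sums_unique[OF sums_single[of n "\<lambda>k. taylor_coeff (S f) k * of_real (weight k)"]] by simp
qed

lemma taylor_series:
  assumes "f \<in> L2 (mu \<alpha> \<beta> \<sigma>)"
  shows "(\<lambda>n. taylor_coeff (S f) n * z ^ n) sums S f z"
proof -
  have "S f \<in> fock (\<alpha> * \<beta>) \<sigma>"
    using S assms unfolding is_segal_bargmann_def is_unitary_def by blast
  then have "S f holomorphic_on ball 0 (cmod z + 1)"
    by (auto simp: fock_def elim: holomorphic_on_subset)
  from holomorphic_power_series[OF this, of z] show ?thesis
    by (simp add: taylor_coeff_def)
qed

text \<open>The norm is read off from unitarity, as the case of \<open>integral_sheffer\<close> in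
  which \<open>f\<close> is the polynomial itself.\<close>

lemma integral_sheffer_square:
  "(LINT x|mu \<alpha> \<beta> \<sigma>. (poly (sheffer \<alpha> \<beta> \<sigma> n) x)\<^sup>2) = weight n"
proof -
  have "complex_of_real (LINT x|mu \<alpha> \<beta> \<sigma>. (poly (sheffer \<alpha> \<beta> \<sigma> n) x)\<^sup>2) = of_real (weight n)"
    using integral_sheffer[OF poly_in_L2, of "sheffer \<alpha> \<beta> \<sigma> n" n]
    by (simp add: S_sheffer taylor_coeff_power power2_eq_square flip: integral_complex_of_real)
  then show ?thesis by (simp only: of_real_eq_iff)
qed

section \<open>Integrals of a square-integrable function against the kernel\<close>

context
  fixes f :: "real \<Rightarrow> complex"
  assumes f: "f \<in> L2 (mu \<alpha> \<beta> \<sigma>)"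
begin

lemma L2_measurable [measurable]: "f \<in> borel_measurable (mu \<alpha> \<beta> \<sigma>)"
  using f by (simp add: L2_def)

lemma integrable_mult_poly: "integrable (mu \<alpha> \<beta> \<sigma>) (\<lambda>x. f x * of_real (poly p x))"
proof (rule Bochner_Integration.integrable_bound)
  show "integrable (mu \<alpha> \<beta> \<sigma>) (\<lambda>x. (cmod (f x))\<^sup>2 + (poly p x)\<^sup>2)"
    using f integrable_poly_square by (simp add: L2_def)
  have "a * b \<le> a\<^sup>2 + b\<^sup>2" if "a \<ge> 0" "b \<ge> 0" for a b :: real
    using sum_squares_bound[of a b] mult_nonneg_nonneg[OF that] by linarith
  from this[of "cmod (f x)" "\<bar>poly p x\<bar>" for x]
  show "AE x in mu \<alpha> \<beta> \<sigma>. norm (f x * of_real (poly p x)) \<le> norm ((cmod (f x))\<^sup>2 + (poly p x)\<^sup>2)"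
    by (simp add: norm_mult)
qed measurable

text \<open>A weighted AM-GM inequality takes the place of Cauchy-Schwarz; the factor in front of
  \<open>sqrt (weight n)\<close> is independent of \<open>n\<close>.\<close>

lemma norm_integral_sheffer_le:
  "(LINT x|mu \<alpha> \<beta> \<sigma>. cmod (f x) * \<bar>poly (sheffer \<alpha> \<beta> \<sigma> n) x\<bar>)
     \<le> ((LINT x|mu \<alpha> \<beta> \<sigma>. (cmod (f x))\<^sup>2) + 1) / 2 * sqrt (weight n)"
proof -
  let ?w = "sqrt (weight n)"
  have w: "?w > 0" using weight_pos by simp
  have "(LINT x|mu \<alpha> \<beta> \<sigma>. cmod (f x) * \<bar>poly (sheffer \<alpha> \<beta> \<sigma> n) x\<bar>)
     \<le> (LINT x|mu \<alpha> \<beta> \<sigma>. ?w / 2 * (cmod (f x))\<^sup>2 + 1 / (2 * ?w) * (poly (sheffer \<alpha> \<beta> \<sigma> n) x)\<^sup>2)"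
  proof (rule integral_mono)
    show "integrable (mu \<alpha> \<beta> \<sigma>) (\<lambda>x. cmod (f x) * \<bar>poly (sheffer \<alpha> \<beta> \<sigma> n) x\<bar>)"
      using integrable_norm[OF integrable_mult_poly] by (simp add: norm_mult)
    show "integrable (mu \<alpha> \<beta> \<sigma>) (\<lambda>x. ?w / 2 * (cmod (f x))\<^sup>2 + 1 / (2 * ?w) * (poly (sheffer \<alpha> \<beta> \<sigma> n) x)\<^sup>2)"
      using f integrable_poly_square
      by (intro Bochner_Integration.integrable_add integrable_mult_right) (auto simp: L2_def)
    \<comment> \<open>The weights are balanced: the squared polynomial has integral
      \<open>weight n\<close>, so the second summand integrates to \<open>?w / 2\<close>.\<close>
    have "a * b \<le> ?w / 2 * a\<^sup>2 + 1 / (2 * ?w) * b\<^sup>2" for a b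
    proof -
      have "0 \<le> (?w * a - b)\<^sup>2 / (2 * ?w)" using w by simp
      also have "\<dots> = ?w / 2 * a\<^sup>2 + 1 / (2 * ?w) * b\<^sup>2 - a * b"
        using w by (simp add: power2_eq_square field_simps)
      finally show ?thesis by simp
    qed
    from this[of "cmod (f x)" "\<bar>poly (sheffer \<alpha> \<beta> \<sigma> n) x\<bar>" for x]
    show "cmod (f x) * \<bar>poly (sheffer \<alpha> \<beta> \<sigma> n) x\<bar> \<le> ?w / 2 * (cmod (f x))\<^sup>2 + 1 / (2 * ?w) * (poly (sheffer \<alpha> \<beta> \<sigma> n) x)\<^sup>2" for x
      by simp
  qed
  also have "\<dots> = ?w / 2 * (LINT x|mu \<alpha> \<beta> \<sigma>. (cmod (f x))\<^sup>2) + 1 / (2 * ?w) * weight n"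
    using f integrable_poly_square
    by (subst Bochner_Integration.integral_add) (auto simp: L2_def integral_sheffer_square)
  also have "1 / (2 * ?w) * weight n = ?w / 2"
    using weight_pos[of n] by (simp add: real_div_sqrt)
  finally show ?thesis by (simp add: field_simps)
qed

text \<open>This bound permits exchanging the series over \<open>m\<close> with the integral.
  Expanding by \<open>rising_conv_sheffer\<close> and applying
  \<open>norm_integral_sheffer_le\<close> bounds the terms by a constant times the Cauchy product of
  the series of \<open>cmod z ^ n / sqrt (weight n)\<close> and
  \<open>(cmod z / \<beta>) ^ n / fact n\<close>.\<close>

lemma summable_norm_integral_rising:
  "summable (\<lambda>m. cmod z ^ m * (LINT x|mu \<alpha> \<beta> \<sigma>. cmod (f x) * (poly (rising m) x / weight m)))"
proof (rule summable_comparison_test')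
  define C where "C = ((LINT x|mu \<alpha> \<beta> \<sigma>. (cmod (f x))\<^sup>2) + 1) / 2"
  let ?a = "\<lambda>n. cmod z ^ n / sqrt (weight n)" and ?b = "\<lambda>n. (cmod z / \<beta>) ^ n / fact n"
  have nn: "sqrt (weight n) > 0" for n using weight_pos by simp
  have "norm (?a n) = ?a n" "norm (?b n) = (cmod z / \<beta>) ^ n /\<^sub>R fact n" for n
    using less_imp_le[OF nn[of n]] \<beta>_pos by (simp_all add: divide_inverse mult.commute)
  then have "summable (\<lambda>n. norm (?a n))" "summable (\<lambda>n. norm (?b n))"
    using summable_inverse_sqrt_weight[of "cmod z"] summable_exp_generic[of "cmod z / \<beta>"] by (simp_all only:)
  then show "summable (\<lambda>m. C * (\<Sum>n\<le>m. ?a n * ?b (m - n)))"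
    by (intro summable_mult summable_Cauchy_product)
  fix m :: nat
  let ?s = "\<lambda>n x. poly (sheffer \<alpha> \<beta> \<sigma> n) x" and ?c = "\<lambda>n. (1 / \<beta>) ^ n / fact n"
  have i: "integrable (mu \<alpha> \<beta> \<sigma>) (\<lambda>x. cmod (f x) * \<bar>poly p x\<bar>)" for p
    using integrable_norm[OF integrable_mult_poly[of p]] by (simp add: norm_mult)
  have c: "?c n \<ge> 0" for n using \<beta>_pos by simp
  have t: "0 \<le> poly (rising m) x / weight m" if "x \<in> space (mu \<alpha> \<beta> \<sigma>)" for x
    using rising_nonneg[OF space_mu_nonneg[OF that]] weight_pos[of m] by simp
  have "(LINT x|mu \<alpha> \<beta> \<sigma>. cmod (f x) * (poly (rising m) x / weight m))
      \<le> (LINT x|mu \<alpha> \<beta> \<sigma>. (\<Sum>n\<le>m. (?c (m - n) / weight n) * (cmod (f x) * \<bar>?s n x\<bar>)))"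
  proof (rule integral_mono)
    have "integrable (mu \<alpha> \<beta> \<sigma>) (\<lambda>x. 1 / weight m * (cmod (f x) * \<bar>poly (rising m) x\<bar>))"
      using i by (rule integrable_mult_right)
    then show "integrable (mu \<alpha> \<beta> \<sigma>) (\<lambda>x. cmod (f x) * (poly (rising m) x / weight m))"
      by (rule Bochner_Integration.integrable_cong[THEN iffD1, OF refl, rotated])
         (use rising_nonneg space_mu_nonneg in auto)
    show "integrable (mu \<alpha> \<beta> \<sigma>) (\<lambda>x. \<Sum>n\<le>m. (?c (m - n) / weight n) * (cmod (f x) * \<bar>?s n x\<bar>))"
      using i by (intro Bochner_Integration.integrable_sum integrable_mult_right)
    fix x assume "x \<in> space (mu \<alpha> \<beta> \<sigma>)"
    have "poly (rising m) x / weight m \<le> (\<Sum>n\<le>m. \<bar>?s n x / weight n * ?c (m - n)\<bar>)"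
      unfolding rising_conv_sheffer by (rule order_trans[OF abs_ge_self sum_abs])
    then have "cmod (f x) * (poly (rising m) x / weight m) \<le> cmod (f x) * (\<Sum>n\<le>m. \<bar>?s n x / weight n * ?c (m - n)\<bar>)"
      by (intro mult_left_mono) auto
    also have "\<dots> = (\<Sum>n\<le>m. (?c (m - n) / weight n) * (cmod (f x) * \<bar>?s n x\<bar>))"
      unfolding sum_distrib_left using weight_pos \<beta>_pos
      by (intro sum.cong) (auto simp: abs_mult abs_of_pos mult_ac)
    finally show "cmod (f x) * (poly (rising m) x / weight m) \<le> (\<Sum>n\<le>m. (?c (m - n) / weight n) * (cmod (f x) * \<bar>?s n x\<bar>))" .
  qed
  also have "\<dots> = (\<Sum>n\<le>m. (?c (m - n) / weight n) * (LINT x|mu \<alpha> \<beta> \<sigma>. cmod (f x) * \<bar>?s n x\<bar>))"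
    using i by simp
  also have "\<dots> \<le> (\<Sum>n\<le>m. (?c (m - n) / weight n) * (C * sqrt (weight n)))"
    unfolding C_def
    by (intro sum_mono mult_left_mono norm_integral_sheffer_le divide_nonneg_nonneg[OF c less_imp_le[OF weight_pos]])
  also have "\<dots> = C * (\<Sum>n\<le>m. 1 / sqrt (weight n) * ?c (m - n))"
    unfolding sum_distrib_left
  proof (intro sum.cong refl)
    fix n
    have r: "sqrt (weight n) / weight n = 1 / sqrt (weight n)"
    proof -
      have "sqrt (weight n) / weight n = 1 / (weight n / sqrt (weight n))" by simp
      then show ?thesis unfolding real_div_sqrt[OF less_imp_le[OF weight_pos]] .
    qed
    have "(?c (m - n) / weight n) * (C * sqrt (weight n)) = C * ((sqrt (weight n) / weight n) * ?c (m - n))"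
      by (simp add: mult_ac)
    then show "(?c (m - n) / weight n) * (C * sqrt (weight n)) = C * (1 / sqrt (weight n) * ?c (m - n))"
      unfolding r .
  qed
  finally have "cmod z ^ m * (LINT x|mu \<alpha> \<beta> \<sigma>. cmod (f x) * (poly (rising m) x / weight m))
      \<le> cmod z ^ m * (C * (\<Sum>n\<le>m. 1 / sqrt (weight n) * ?c (m - n)))"
    by (intro mult_left_mono) auto
  also have "\<dots> = C * (\<Sum>n\<le>m. cmod z ^ m * (1 / sqrt (weight n) * ?c (m - n)))"
    by (simp add: sum_distrib_left mult.left_commute)
  also have "(\<Sum>n\<le>m. cmod z ^ m * (1 / sqrt (weight n) * ?c (m - n))) = (\<Sum>n\<le>m. ?a n * ?b (m - n))"
  proof (intro sum.cong refl)
    fix n assume "n \<in> {..m}"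
    then have "cmod z ^ m = cmod z ^ n * cmod z ^ (m - n)" by (simp flip: power_add)
    then show "cmod z ^ m * (1 / sqrt (weight n) * ?c (m - n)) = ?a n * ?b (m - n)"
      by (simp add: power_divide)
  qed
  finally have *: "cmod z ^ m * (LINT x|mu \<alpha> \<beta> \<sigma>. cmod (f x) * (poly (rising m) x / weight m))
      \<le> C * (\<Sum>n\<le>m. ?a n * ?b (m - n))" .
  have "0 \<le> (LINT x|mu \<alpha> \<beta> \<sigma>. cmod (f x) * (poly (rising m) x / weight m))"
    using t by (intro Bochner_Integration.integral_nonneg mult_nonneg_nonneg norm_ge_zero)
  with * show "norm (cmod z ^ m * (LINT x|mu \<alpha> \<beta> \<sigma>. cmod (f x) * (poly (rising m) x / weight m))) \<le> C * (\<Sum>n\<le>m. ?a n * ?b (m - n))"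
    by (simp only: real_norm_def abs_of_nonneg[OF mult_nonneg_nonneg[OF zero_le_power[OF norm_ge_zero]]])
qed

text \<open>The series in \<open>kernel\<close> is integrated term by term, which absolute
  convergence at each point (\<open>summable_kernel\<close>) and in the mean
  (\<open>summable_norm_integral_rising\<close>) permits. The factor
  \<open>exp (z / \<beta>)\<close> undoes the prefactor of \<open>kernel\<close>.\<close>

lemma integrable_kernel: "integrable (mu \<alpha> \<beta> \<sigma>) (\<lambda>x. f x * kernel z x)"
  and sums_integral_kernel:
    "(\<lambda>m. z ^ m * (LINT x|mu \<alpha> \<beta> \<sigma>. f x * of_real (poly (rising m) x / weight m)))
       sums (exp (z / of_real \<beta>) * (LINT x|mu \<alpha> \<beta> \<sigma>. f x * kernel z x))"
proof -
  let ?t = "\<lambda>m x. poly (rising m) x / weight m"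
  let ?g = "\<lambda>m x. f x * (z ^ m * of_real (?t m x))"
  have t: "0 \<le> ?t m x" if "x \<in> space (mu \<alpha> \<beta> \<sigma>)" for m x
    using rising_nonneg[OF space_mu_nonneg[OF that]] weight_pos[of m] by simp
  have int: "integrable (mu \<alpha> \<beta> \<sigma>) (?g m)" for m
    using integrable_mult_right[OF integrable_mult_poly[of "rising m"], of "z ^ m / of_real (weight m)"]
    by (simp add: mult_ac)
  have s: "summable (\<lambda>m. norm (?g m x))" if "x \<in> space (mu \<alpha> \<beta> \<sigma>)" for x
    using summable_mult[OF summable_kernel[OF space_mu_nonneg[OF that], of z], of "cmod (f x)"]
    by (simp only: norm_mult)
  have "(LINT x|mu \<alpha> \<beta> \<sigma>. norm (?g m x)) = cmod z ^ m * (LINT x|mu \<alpha> \<beta> \<sigma>. cmod (f x) * ?t m x)" for m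
  proof -
    have "(LINT x|mu \<alpha> \<beta> \<sigma>. norm (?g m x)) = (LINT x|mu \<alpha> \<beta> \<sigma>. cmod z ^ m * (cmod (f x) * ?t m x))"
      using t by (intro Bochner_Integration.integral_cong refl)
        (simp add: norm_mult norm_power abs_of_nonneg mult_ac del: of_real_divide abs_divide times_divide_eq_right times_divide_eq_left)
    then show ?thesis by simp
  qed
  then have s': "summable (\<lambda>m. LINT x|mu \<alpha> \<beta> \<sigma>. norm (?g m x))"
    using summable_norm_integral_rising[of z] by simp
  have k: "exp (z / of_real \<beta>) * (f x * kernel z x) = (\<Sum>m. ?g m x)" if "x \<in> space (mu \<alpha> \<beta> \<sigma>)" for x
  proof -
    have "(\<Sum>m. ?g m x) = f x * (\<Sum>m. z ^ m * of_real (?t m x))"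
      by (rule suminf_mult[OF summable_norm_cancel[OF summable_kernel[OF space_mu_nonneg[OF that]]]])
    moreover have "exp (z / of_real \<beta>) * exp (- z / of_real \<beta>) = 1"
      by (simp add: exp_minus)
    ultimately show ?thesis by (simp add: kernel_def mult.left_commute del: of_real_divide)
  qed
  have "integrable (mu \<alpha> \<beta> \<sigma>) (\<lambda>x. \<Sum>m. ?g m x)"
    using int s s' by (intro integrable_suminf AE_I2)
  then have i: "integrable (mu \<alpha> \<beta> \<sigma>) (\<lambda>x. exp (z / of_real \<beta>) * (f x * kernel z x))"
    using k by (subst Bochner_Integration.integrable_cong[OF refl]) auto
  then show "integrable (mu \<alpha> \<beta> \<sigma>) (\<lambda>x. f x * kernel z x)"
    using integrable_mult_right[OF i, of "exp (- z / of_real \<beta>)"]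
    by (simp add: exp_minus mult.assoc[symmetric])
  have "(\<lambda>m. LINT x|mu \<alpha> \<beta> \<sigma>. ?g m x) sums (LINT x|mu \<alpha> \<beta> \<sigma>. (\<Sum>m. ?g m x))"
    using int s s' by (intro sums_integral AE_I2)
  also have "(LINT x|mu \<alpha> \<beta> \<sigma>. (\<Sum>m. ?g m x)) = (LINT x|mu \<alpha> \<beta> \<sigma>. exp (z / of_real \<beta>) * (f x * kernel z x))"
    using k by (intro Bochner_Integration.integral_cong) auto
  also have "(\<lambda>m. LINT x|mu \<alpha> \<beta> \<sigma>. ?g m x) = (\<lambda>m. z ^ m * (LINT x|mu \<alpha> \<beta> \<sigma>. f x * of_real (?t m x)))"
    by (simp only: mult.left_commute[of _ "z ^ _"] integral_mult_right_zero)
  finally show "(\<lambda>m. z ^ m * (LINT x|mu \<alpha> \<beta> \<sigma>. f x * of_real (?t m x)))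
       sums (exp (z / of_real \<beta>) * (LINT x|mu \<alpha> \<beta> \<sigma>. f x * kernel z x))"
    by simp
qed

text \<open>Both sides times \<open>exp (z / \<beta>)\<close> are sums of the same series: on the
  left the Cauchy product of the Taylor series with the exponential series, on the right the series
  of \<open>sums_integral_kernel\<close>.\<close>

lemma S_conv_kernel: "S f z = (LINT x|mu \<alpha> \<beta> \<sigma>. f x * kernel z x)"
proof -
  let ?a = "\<lambda>n. taylor_coeff (S f) n * z ^ n" and ?b = "\<lambda>n. (z / of_real \<beta>) ^ n / fact n"
  let ?s = "\<lambda>n x. poly (sheffer \<alpha> \<beta> \<sigma> n) x" and ?c = "\<lambda>n. (1 / \<beta>) ^ n / fact n"
  \<comment> \<open>Convergence at the larger radius \<open>cmod z + 1\<close> gives absolute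
    convergence at \<open>z\<close>.\<close>
  have "summable (\<lambda>n. norm (?a n))"
  proof (rule powser_insidea)
    show "summable (\<lambda>n. taylor_coeff (S f) n * (of_real (cmod z + 1)) ^ n)"
      using taylor_series[OF f] by (rule sums_summable)
  qed simp
  moreover have "summable (\<lambda>n. norm (?b n))"
    using summable_norm_exp[of "z / of_real \<beta>"] by (simp only: exp_series_complex)
  ultimately have "(\<lambda>m. \<Sum>n\<le>m. ?a n * ?b (m - n)) sums ((\<Sum>n. ?a n) * (\<Sum>n. ?b n))"
    by (rule Cauchy_product_sums)
  also have "(\<Sum>n. ?a n) = S f z" using taylor_series[OF f] by (simp add: sums_iff)
  also have "(\<Sum>n. ?b n) = exp (z / of_real \<beta>)"
    by (simp only: exp_def exp_series_complex)
  finally have cauchy: "(\<lambda>m. \<Sum>n\<le>m. ?a n * ?b (m - n)) sums (S f z * exp (z / of_real \<beta>))" .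
  \<comment> \<open>Integrating \<open>rising_conv_sheffer\<close> against \<open>f\<close> and
    inserting \<open>integral_sheffer\<close> cancels the weights and leaves the Cauchy
    product.\<close>
  have conv: "(\<Sum>n\<le>m. ?a n * ?b (m - n)) = z ^ m * (LINT x|mu \<alpha> \<beta> \<sigma>. f x * of_real (poly (rising m) x / weight m))" for m
  proof -
    have "(LINT x|mu \<alpha> \<beta> \<sigma>. f x * of_real (poly (rising m) x / weight m)) =
        (LINT x|mu \<alpha> \<beta> \<sigma>. (\<Sum>n\<le>m. of_real (?c (m - n) / weight n) * (f x * of_real (?s n x))))"
      unfolding rising_conv_sheffer of_real_sum sum_distrib_left
      by (intro Bochner_Integration.integral_cong sum.cong refl) (simp add: mult_ac)
    also have "\<dots> = (\<Sum>n\<le>m. of_real (?c (m - n) / weight n) * (LINT x|mu \<alpha> \<beta> \<sigma>. f x * of_real (?s n x)))"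
      by (subst Bochner_Integration.integral_sum)
         (simp_all only: integrable_mult_right integrable_mult_poly integral_mult_right_zero)
    also have "\<dots> = (\<Sum>n\<le>m. taylor_coeff (S f) n * of_real (?c (m - n)))"
    proof (intro sum.cong refl)
      fix n
      show "of_real (?c (m - n) / weight n) * (LINT x|mu \<alpha> \<beta> \<sigma>. f x * of_real (?s n x)) = taylor_coeff (S f) n * of_real (?c (m - n))"
        unfolding integral_sheffer[OF f] using weight_pos[of n] by simp
    qed
    finally have "z ^ m * (LINT x|mu \<alpha> \<beta> \<sigma>. f x * of_real (poly (rising m) x / weight m))
      = (\<Sum>n\<le>m. z ^ m * (taylor_coeff (S f) n * of_real (?c (m - n))))"
      by (simp only: sum_distrib_left)
    also have "\<dots> = (\<Sum>n\<le>m. ?a n * ?b (m - n))"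
    proof (intro sum.cong refl)
      fix n assume "n \<in> {..m}"
      then have "z ^ m = z ^ n * z ^ (m - n)" by (simp flip: power_add)
      then show "z ^ m * (taylor_coeff (S f) n * of_real (?c (m - n))) = ?a n * ?b (m - n)"
        by (simp add: power_divide)
    qed
    finally show ?thesis by (rule sym)
  qed
  have "exp (z / of_real \<beta>) * (LINT x|mu \<alpha> \<beta> \<sigma>. f x * kernel z x) = S f z * exp (z / of_real \<beta>)"
    using sums_integral_kernel[of z] cauchy unfolding conv by (rule sums_unique2)
  then show ?thesis by simp
qed

end

section \<open>The complex measure \<open>rho\<close> and its density\<close>

lemma integrable_kernel': "integrable (mu \<alpha> \<beta> \<sigma>) (kernel z)"
  using integrable_kernel[OF poly_in_L2[of 1], of z] by simp

text \<open>By \<open>mu_shift\<close> the integral over \<xi> becomes a series of integrals of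
  \<open>rising m\<close> over \<open>A\<close>, and \<open>sums_integral_kernel\<close> for the
  indicator of \<open>A\<close> sums it.\<close>

lemma rho_conv_kernel:
  assumes A: "A \<in> sets (mu \<alpha> \<beta> \<sigma>)"
  shows "rho \<alpha> \<beta> \<sigma> z A = (LINT x:A|mu \<alpha> \<beta> \<sigma>. kernel z x)"
proof -
  define \<zeta> where "\<zeta> = z / of_real \<beta>"
  let ?t = "\<lambda>m x. poly (rising m) x / weight m"
  define I where "I = (\<lambda>m. LINT x|mu \<alpha> \<beta> \<sigma>. indicator A x * ?t m x)"
  \<comment> \<open>The density of the complex Poisson measure with respect to counting measure, so
    that \<open>cm_integral_density\<close> evaluates the integral in
    \<open>rho_def\<close>.\<close>
  define h where "h = (\<lambda>n::nat. exp (- \<zeta>) * (\<zeta> ^ n / fact n))"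
  have h: "integrable (count_space UNIV) h"
    unfolding integrable_count_space_nat_iff h_def norm_mult
    using summable_norm_exp[of \<zeta>] by (intro summable_mult) (simp only: exp_series_complex)
  have poisson: "complex_poisson \<zeta> B = (LINT n:B|count_space UNIV. h n)" for B
  proof -
    have "integrable (count_space UNIV) (\<lambda>n. indicat_real B n *\<^sub>R h n)"
      using h by (intro integrable_mult_indicator) auto
    moreover have "summable (\<lambda>n. \<zeta> ^ n / fact n * indicator B n)"
    proof (rule summable_norm_cancel, rule summable_comparison_test')
      show "summable (\<lambda>n. norm (\<zeta> ^ n /\<^sub>R fact n))" by (rule summable_norm_exp)
      show "norm (norm (\<zeta> ^ n / fact n * indicator B n)) \<le> norm (\<zeta> ^ n /\<^sub>R fact n)" for n
        by (simp add: exp_series_complex split: split_indicator)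
    qed
    ultimately show ?thesis
      by (simp add: complex_poisson_def set_lebesgue_integral_def integral_count_space_nat h_def
          scaleR_conv_of_real of_real_indicator mult_ac flip: suminf_mult)
  qed
  have meas: "measure (mu \<alpha> \<beta> (\<alpha> * \<beta> * real m + \<sigma>)) A = fact m * \<beta> ^ m * I m" for m
  proof -
    let ?d = "\<lambda>x. fact m * \<beta> ^ m * ?t m x"
    have i: "integrable (mu \<alpha> \<beta> \<sigma>) (\<lambda>x. indicator A x * ?d x)"
      using integrable_mult_right[OF integrable_mult_indicator[OF A integrable_rising[of m]], of "fact m * \<beta> ^ m / weight m"]
      by (simp add: mult_ac)
    have d: "0 \<le> ?d x" if "x \<in> space (mu \<alpha> \<beta> \<sigma>)" for x
      using rising_nonneg[OF space_mu_nonneg[OF that]] \<beta>_pos weight_pos[of m] by simp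
    have "emeasure (mu \<alpha> \<beta> (\<alpha> * \<beta> * real m + \<sigma>)) A = (\<integral>\<^sup>+x. ennreal (?d x) * indicator A x \<partial>mu \<alpha> \<beta> \<sigma>)"
      unfolding mu_shift using A by (intro emeasure_density) measurable
    also have "\<dots> = (\<integral>\<^sup>+x. ennreal (indicator A x * ?d x) \<partial>mu \<alpha> \<beta> \<sigma>)"
      by (intro nn_integral_cong) (auto split: split_indicator)
    also have "\<dots> = ennreal (LINT x|mu \<alpha> \<beta> \<sigma>. indicator A x * ?d x)"
      using i d by (intro nn_integral_eq_integral AE_I2) (auto split: split_indicator)
    finally have "measure (mu \<alpha> \<beta> (\<alpha> * \<beta> * real m + \<sigma>)) A = (LINT x|mu \<alpha> \<beta> \<sigma>. indicator A x * ?d x)"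
      unfolding measure_def using d
      by (subst enn2real_ennreal[symmetric, OF Bochner_Integration.integral_nonneg])
         (auto split: split_indicator)
    also have "\<dots> = fact m * \<beta> ^ m * I m"
      unfolding I_def by (simp only: mult.left_commute[of _ "fact m * \<beta> ^ m"] integral_mult_right_zero)
    finally show ?thesis .
  qed
  let ?m = "\<lambda>n. complex_of_real (measure (mu \<alpha> \<beta> (\<alpha> * \<beta> * real n + \<sigma>)) A)"
  \<comment> \<open>With \<open>\<zeta> = z / \<beta>\<close>, the Poisson weight
    \<open>\<zeta> ^ n / fact n\<close> cancels the factor \<open>fact n * \<beta> ^ n\<close> from
    \<open>mu_shift\<close>.\<close>
  have mh: "?m n * h n = exp (- \<zeta>) * (z ^ n * of_real (I n))" for n
    unfolding meas h_def \<zeta>_def using \<beta>_pos by (simp add: power_divide)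
  have I: "of_real (I m) = (LINT x|mu \<alpha> \<beta> \<sigma>. of_real (indicator A x) * complex_of_real (?t m x))" for m
    unfolding I_def by (simp flip: integral_complex_of_real)
  have "norm (z ^ m * of_real (I m)) = cmod z ^ m * (LINT x|mu \<alpha> \<beta> \<sigma>. cmod (of_real (indicator A x)) * ?t m x)" for m
  proof -
    have "0 \<le> I m" unfolding I_def
      using rising_nonneg[OF space_mu_nonneg] weight_pos[of m] by (intro Bochner_Integration.integral_nonneg) simp
    moreover have "(LINT x|mu \<alpha> \<beta> \<sigma>. cmod (of_real (indicator A x)) * ?t m x) = I m"
      unfolding I_def by simp
    ultimately show ?thesis by (simp add: norm_mult norm_power)
  qed
  then have "summable (\<lambda>m. norm (z ^ m * of_real (I m)))"
    using summable_norm_integral_rising[OF indicator_in_L2[OF A], of z] by (simp only:)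
  then have int: "integrable (count_space UNIV) (\<lambda>n. ?m n * h n)"
    unfolding integrable_count_space_nat_iff mh norm_mult[of "exp (- \<zeta>)"] by (rule summable_mult)
  have "rho \<alpha> \<beta> \<sigma> z A = (LINT n|count_space UNIV. ?m n * h n)"
    unfolding rho_def \<zeta>_def[symmetric] using h poisson int by (intro cm_integral_density) auto
  also have "\<dots> = (\<Sum>n. exp (- \<zeta>) * (z ^ n * of_real (I n)))"
    using int by (simp only: integral_count_space_nat mh)
  also have "\<dots> = exp (- \<zeta>) * (exp \<zeta> * (LINT x|mu \<alpha> \<beta> \<sigma>. of_real (indicator A x) * kernel z x))"
    using sums_mult[OF sums_integral_kernel[OF indicator_in_L2[OF A], of z], of "exp (- \<zeta>)"]
    unfolding \<zeta>_def[symmetric] I by (rule sums_unique[symmetric])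
  also have "\<dots> = (LINT x:A|mu \<alpha> \<beta> \<sigma>. kernel z x)"
    by (simp add: set_lebesgue_integral_def scaleR_conv_of_real exp_minus)
  finally show ?thesis .
qed

end

theorem theorem3p3:
  fixes \<alpha> \<beta> \<sigma> :: real
    and S :: "(real \<Rightarrow> complex) \<Rightarrow> (complex \<Rightarrow> complex)"
  assumes "\<alpha> \<ge> \<beta>" and "\<beta> > 0" and "\<sigma> > 0"
    and "is_segal_bargmann \<alpha> \<beta> \<sigma> S"
  shows "(\<forall>z. complex_measure (mu \<alpha> \<beta> \<sigma>) (rho \<alpha> \<beta> \<sigma> z)) \<and>
         (\<forall>f\<in>L2 (mu \<alpha> \<beta> \<sigma>). \<forall>z.
            cm_integrable (mu \<alpha> \<beta> \<sigma>) (rho \<alpha> \<beta> \<sigma> z) f \<and>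
            S f z = cm_integral (mu \<alpha> \<beta> \<sigma>) (rho \<alpha> \<beta> \<sigma> z) f)"
proof -
  interpret segal_bargmann_transform \<alpha> \<beta> \<sigma> S
    using assms by unfold_locales
  show ?thesis
  proof (intro conjI allI ballI)
    show "complex_measure (mu \<alpha> \<beta> \<sigma>) (rho \<alpha> \<beta> \<sigma> z)" for z
      by (rule complex_measure_density[OF integrable_kernel' rho_conv_kernel])
    fix f z assume f: "f \<in> L2 (mu \<alpha> \<beta> \<sigma>)"
    \<comment> \<open>Once \<open>rho\<close> is known to have density \<open>kernel z\<close>,
      integrability and the value of the integral both come from the general statement on
      densities.\<close>
    note cm = cm_integral_density[OF integrable_kernel' rho_conv_kernel L2_measurable[OF f] integrable_kernel[OF f]]
    show "cm_integrable (mu \<alpha> \<beta> \<sigma>) (rho \<alpha> \<beta> \<sigma> z) f" by (rule cm(1))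
    show "S f z = cm_integral (mu \<alpha> \<beta> \<sigma>) (rho \<alpha> \<beta> \<sigma> z) f"
      unfolding S_conv_kernel[OF f] by (rule cm(2)[symmetric])
  qed
qed

end
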